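(* Let $\Gamma$ be a discrete group, $G$ a locally compact, Hausdorff groupoid with totally disconnected unit space such that $s : G \to G^{(0)}$ is a local homeomorphism, and $c : G \to \Gamma$ a continuous cocycle. Then $\{1_U : U \in B^{\mathrm{co}}_*(G)\} \subseteq A(G)$ is a representation of $B^{\mathrm{co}}_*(G)$ which spans $A(G)$. Moreover, $A(G)$ is universal for representations of $B^{\mathrm{co}}_*(G)$ in the sense that for every representation $\{t_U : U \in B^{\mathrm{co}}_*(G)\}$ of $B^{\mathrm{co}}_*(G)$ in a complex algebra $B$, there is a unique homomorphism $\pi : A(G) \to B$ such that $\pi(1_U) = t_U$ for all $U \in B^{\mathrm{co}}_*(G)$.
   Context: A groupoid is a small category with inverses; a topological groupoid carries a topology making range, source, inversion and composition continuous. $G^{(0)}$ is the unit space, $r,s: G\to G^{(0)}$ the range and source maps; $\alpha\beta$ is defined iff $s(\alpha)=r(\beta)$. "Totally disconnected" for $G^{(0)}$ means it has a basis of clopen sets. A continuous cocycle $c:G\to\Gamma$ is a continuous map with $c(\alpha\beta)=c(\alpha)c(\beta)$ for composable $\alpha,\beta$. For $U,V\subseteq G$, $UV:=\{\alpha\beta:\alpha\in U,\beta\in V, s(\alpha)=r(\beta)\}$. An open bisection is an open $U\subseteq G$ such that $r|_U$ and $s|_U$ are homeomorphisms onto their images. For a function $f$, $\operatorname{supp}(f):=\{x: f(x)\neq 0\}$; $C_c(G)$ is the space of continuous compactly supported functions $G\to\mathbb{C}$. A function is locally constant if every point has a neighbourhood on which it is constant. For $n\in\Gamma$, $G_n:=c^{-1}(n)$,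 $A_n:=\{f\in C_c(G): \operatorname{supp}(f)\subseteq G_n,\ f \text{ locally constant}\}$, and $A(G):=\operatorname{span}\{A_n:n\in\Gamma\}\subseteq C_c(G)$. $A(G)$ is a complex algebra under $(f*g)(\gamma)=\sum_{r(\alpha)=r(\gamma)}f(\alpha)g(\alpha^{-1}\gamma)$. $1_U$ is the indicator function of $U$. $B^{\mathrm{co}}_n(G)$ is the collection of all compact open bisections $U$ of $G$ with $U\subseteq c^{-1}(n)$, and $B^{\mathrm{co}}_*(G):=\bigcup_{n\in\Gamma}B^{\mathrm{co}}_n(G)$. Let $B$ be an algebra over $\mathbb{C}$. A representation of $B^{\mathrm{co}}_*(G)$ in $B$ is a family $\{t_U:U\in B^{\mathrm{co}}_*(G)\}\subseteq B$ satisfying: (R1) $t_\emptyset=0$; (R2) $t_Ut_V=t_{UV}$ for all $U,V\in B^{\mathrm{co}}_*(G)$; (R3) $t_U+t_V=t_{U\cup V}$ whenever $U$ and $V$ are disjoint elements of $B^{\mathrm{co}}_n(G)$ for some $n$ such that $U\cup V\in B^{\mathrm{co}}_n(G)$. Algebras need not be unital and homomorphisms are $\mathbb{C}$-linear multiplicative maps. *)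

theory Defs
  imports
    "HOL-Analysis.Analysis"
    "HOL-Library.Function_Algebras"
    "HOL-Algebra.Module"
begin

no_notation eq_closure_of (\<open>closure'_of\<index>\<close>)  (* keep the topological reading *)

section \<open>Topological groupoids\<close>

text \<open>
  A groupoid is presented by its set of arrows; an object is identified with its identity
  arrow, so source and range map arrows to arrows. The composite \<open>cmp G \<alpha> \<beta>\<close> is meaningful
  only when \<open>src G \<alpha> = rng G \<beta>\<close>.
\<close>

record 'g groupoid =
  arrows :: "'g set"
  src :: "'g \<Rightarrow> 'g"
  rng :: "'g \<Rightarrow> 'g"
  cmp :: "'g \<Rightarrow> 'g \<Rightarrow> 'g"
  ginv :: "'g \<Rightarrow> 'g"

record 'g topgroupoid = "'g groupoid" +
  gtop :: "'g topology"

definition units :: "('g, 'm) groupoid_scheme \<Rightarrow> 'g set" where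
  "units G = {u \<in> arrows G. src G u = u \<and> rng G u = u}"

definition composable :: "('g, 'm) groupoid_scheme \<Rightarrow> ('g \<times> 'g) set" where
  "composable G = {(\<alpha>, \<beta>). \<alpha> \<in> arrows G \<and> \<beta> \<in> arrows G \<and> src G \<alpha> = rng G \<beta>}"

locale groupoid =
  fixes G :: "('g, 'm) groupoid_scheme" (structure)
  assumes src_units: "\<alpha> \<in> arrows G \<Longrightarrow> src G \<alpha> \<in> units G"
    and rng_units: "\<alpha> \<in> arrows G \<Longrightarrow> rng G \<alpha> \<in> units G"
    and cmp_closed: "(\<alpha>, \<beta>) \<in> composable G \<Longrightarrow> cmp G \<alpha> \<beta> \<in> arrows G"
    and src_cmp: "(\<alpha>, \<beta>) \<in> composable G \<Longrightarrow> src G (cmp G \<alpha> \<beta>) = src G \<beta>"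
    and rng_cmp: "(\<alpha>, \<beta>) \<in> composable G \<Longrightarrow> rng G (cmp G \<alpha> \<beta>) = rng G \<alpha>"
    and cmp_assoc: "(\<alpha>, \<beta>) \<in> composable G \<Longrightarrow> (\<beta>, \<gamma>) \<in> composable G \<Longrightarrow>
      cmp G (cmp G \<alpha> \<beta>) \<gamma> = cmp G \<alpha> (cmp G \<beta> \<gamma>)"
    and cmp_src: "\<alpha> \<in> arrows G \<Longrightarrow> cmp G \<alpha> (src G \<alpha>) = \<alpha>"
    and rng_cmp_id: "\<alpha> \<in> arrows G \<Longrightarrow> cmp G (rng G \<alpha>) \<alpha> = \<alpha>"
    and ginv_closed: "\<alpha> \<in> arrows G \<Longrightarrow> ginv G \<alpha> \<in> arrows G"
    and src_ginv: "\<alpha> \<in> arrows G \<Longrightarrow> src G (ginv G \<alpha>) = rng G \<alpha>"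
    and rng_ginv: "\<alpha> \<in> arrows G \<Longrightarrow> rng G (ginv G \<alpha>) = src G \<alpha>"
    and cmp_ginv: "\<alpha> \<in> arrows G \<Longrightarrow> cmp G \<alpha> (ginv G \<alpha>) = rng G \<alpha>"
    and ginv_cmp: "\<alpha> \<in> arrows G \<Longrightarrow> cmp G (ginv G \<alpha>) \<alpha> = src G \<alpha>"

definition unit_top :: "('g, 'm) topgroupoid_scheme \<Rightarrow> 'g topology" where
  "unit_top G = subtopology (gtop G) (units G)"

locale topological_groupoid = groupoid G
  for G :: "('g, 'm) topgroupoid_scheme" (structure) +
  assumes topspace_gtop: "topspace (gtop G) = arrows G"
    and continuous_src: "continuous_map (gtop G) (unit_top G) (src G)"
    and continuous_rng: "continuous_map (gtop G) (unit_top G) (rng G)"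
    and continuous_ginv: "continuous_map (gtop G) (gtop G) (ginv G)"
    and continuous_cmp:
      "continuous_map (subtopology (prod_topology (gtop G) (gtop G)) (composable G)) (gtop G)
        (\<lambda>(\<alpha>, \<beta>). cmp G \<alpha> \<beta>)"

definition has_clopen_basis :: "'a topology \<Rightarrow> bool" where
  "has_clopen_basis X \<longleftrightarrow>
    (\<exists>\<B>. (\<forall>B\<in>\<B>. openin X B \<and> closedin X B) \<and>
         (\<forall>W. openin X W \<longrightarrow> (\<exists>\<C>\<subseteq>\<B>. \<Union>\<C> = W)))"

definition local_homeomorphism :: "'a topology \<Rightarrow> 'b topology \<Rightarrow> ('a \<Rightarrow> 'b) \<Rightarrow> bool" where
  "local_homeomorphism X Y f \<longleftrightarrow>
    (\<forall>x\<in>topspace X. \<exists>U. openin X U \<and> x \<in> U \<and> openin Y (f ` U) \<and>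
       homeomorphic_map (subtopology X U) (subtopology Y (f ` U)) f)"

definition continuous_cocycle ::
    "('g, 'm) topgroupoid_scheme \<Rightarrow> ('h, 'k) monoid_scheme \<Rightarrow> ('g \<Rightarrow> 'h) \<Rightarrow> bool" where
  "continuous_cocycle G \<Gamma> c \<longleftrightarrow>
    continuous_map (gtop G) (discrete_topology (carrier \<Gamma>)) c \<and>
    (\<forall>(\<alpha>, \<beta>)\<in>composable G. c (cmp G \<alpha> \<beta>) = c \<alpha> \<otimes>\<^bsub>\<Gamma>\<^esub> c \<beta>)"

definition set_cmp :: "('g, 'm) groupoid_scheme \<Rightarrow> 'g set \<Rightarrow> 'g set \<Rightarrow> 'g set" where
  "set_cmp G U V = {cmp G \<alpha> \<beta> | \<alpha> \<beta>. \<alpha> \<in> U \<and> \<beta> \<in> V \<and> src G \<alpha> = rng G \<beta>}"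

definition open_bisection :: "('g, 'm) topgroupoid_scheme \<Rightarrow> 'g set \<Rightarrow> bool" where
  "open_bisection G U \<longleftrightarrow> openin (gtop G) U \<and>
    homeomorphic_map (subtopology (gtop G) U) (subtopology (unit_top G) (rng G ` U)) (rng G) \<and>
    homeomorphic_map (subtopology (gtop G) U) (subtopology (unit_top G) (src G ` U)) (src G)"

definition fibre :: "('g, 'm) groupoid_scheme \<Rightarrow> ('g \<Rightarrow> 'h) \<Rightarrow> 'h \<Rightarrow> 'g set" where
  "fibre G c n = {\<alpha> \<in> arrows G. c \<alpha> = n}"

definition Bco :: "('g, 'm) topgroupoid_scheme \<Rightarrow> ('g \<Rightarrow> 'h) \<Rightarrow> 'h \<Rightarrow> 'g set set" where
  "Bco G c n = {U. compactin (gtop G) U \<and> open_bisection G U \<and> U \<subseteq> fibre G c n}"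

definition Bco_all ::
    "('g, 'm) topgroupoid_scheme \<Rightarrow> ('h, 'k) monoid_scheme \<Rightarrow> ('g \<Rightarrow> 'h) \<Rightarrow> 'g set set" where
  "Bco_all G \<Gamma> c = (\<Union>n\<in>carrier \<Gamma>. Bco G c n)"

section \<open>Complex algebras\<close>

text \<open>
  Algebras are not assumed unital: the \<open>one\<close> field of the record is left unconstrained.
  \<open>Module.module\<close> is the module locale of HOL-Algebra (not the one of HOL.Modules).
\<close>

definition complex_field :: "complex ring" where
  "complex_field = \<lparr>carrier = UNIV, monoid.mult = (*), one = 1, ring.zero = 0, add = (+)\<rparr>"

lemma cring_complex_field: "cring complex_field"
proof -
  have "\<exists>y. y + x = 0 \<and> x + y = 0" for x :: complex
    by (rule exI[of _ "- x"]) simp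
  then show ?thesis
    unfolding complex_field_def
    by unfold_locales (auto simp: algebra_simps Units_def)
qed

locale complex_algebra = Module.module complex_field B
  for B :: "(complex, 'b, 'm) module_scheme" (structure) +
  assumes mult_closed: "x \<in> carrier B \<Longrightarrow> y \<in> carrier B \<Longrightarrow> x \<otimes>\<^bsub>B\<^esub> y \<in> carrier B"
    and mult_assoc: "x \<in> carrier B \<Longrightarrow> y \<in> carrier B \<Longrightarrow> z \<in> carrier B \<Longrightarrow>
      (x \<otimes>\<^bsub>B\<^esub> y) \<otimes>\<^bsub>B\<^esub> z = x \<otimes>\<^bsub>B\<^esub> (y \<otimes>\<^bsub>B\<^esub> z)"
    and mult_distr_left: "x \<in> carrier B \<Longrightarrow> y \<in> carrier B \<Longrightarrow> z \<in> carrier B \<Longrightarrow>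
      (x \<oplus>\<^bsub>B\<^esub> y) \<otimes>\<^bsub>B\<^esub> z = (x \<otimes>\<^bsub>B\<^esub> z) \<oplus>\<^bsub>B\<^esub> (y \<otimes>\<^bsub>B\<^esub> z)"
    and mult_distr_right: "x \<in> carrier B \<Longrightarrow> y \<in> carrier B \<Longrightarrow> z \<in> carrier B \<Longrightarrow>
      x \<otimes>\<^bsub>B\<^esub> (y \<oplus>\<^bsub>B\<^esub> z) = (x \<otimes>\<^bsub>B\<^esub> y) \<oplus>\<^bsub>B\<^esub> (x \<otimes>\<^bsub>B\<^esub> z)"
    and smult_mult_left: "x \<in> carrier B \<Longrightarrow> y \<in> carrier B \<Longrightarrow>
      (a \<odot>\<^bsub>B\<^esub> x) \<otimes>\<^bsub>B\<^esub> y = a \<odot>\<^bsub>B\<^esub> (x \<otimes>\<^bsub>B\<^esub> y)"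
    and smult_mult_right: "x \<in> carrier B \<Longrightarrow> y \<in> carrier B \<Longrightarrow>
      x \<otimes>\<^bsub>B\<^esub> (a \<odot>\<^bsub>B\<^esub> y) = a \<odot>\<^bsub>B\<^esub> (x \<otimes>\<^bsub>B\<^esub> y)"

text \<open>
  Homomorphisms are extensional (\<open>undefined\<close> off the carrier), so that equality of elements of
  \<open>algebra_hom A B\<close> is equality as maps on the carrier of \<open>A\<close>.
\<close>

definition algebra_hom ::
    "(complex, 'a, 'm) module_scheme \<Rightarrow> (complex, 'b, 'n) module_scheme \<Rightarrow> ('a \<Rightarrow> 'b) set" where
  "algebra_hom A B = {\<pi> \<in> carrier A \<rightarrow>\<^sub>E carrier B.
    (\<forall>x\<in>carrier A. \<forall>y\<in>carrier A. \<pi> (x \<oplus>\<^bsub>A\<^esub> y) = \<pi> x \<oplus>\<^bsub>B\<^esub> \<pi> y) \<and>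
    (\<forall>a. \<forall>x\<in>carrier A. \<pi> (a \<odot>\<^bsub>A\<^esub> x) = a \<odot>\<^bsub>B\<^esub> \<pi> x) \<and>
    (\<forall>x\<in>carrier A. \<forall>y\<in>carrier A. \<pi> (x \<otimes>\<^bsub>A\<^esub> y) = \<pi> x \<otimes>\<^bsub>B\<^esub> \<pi> y)}"

section \<open>The algebra \<open>A(G)\<close>\<close>

text \<open>
  A function on \<open>G\<close> is represented by its extension by zero to the whole type. Addition and
  zero of functions are the pointwise ones of \<open>Function_Algebras\<close>.
\<close>

definition fun_scale :: "complex \<Rightarrow> ('g \<Rightarrow> complex) \<Rightarrow> 'g \<Rightarrow> complex" where
  "fun_scale a f = (\<lambda>x. a * f x)"

interpretation cfun: vector_space fun_scale
  by unfold_locales (auto simp: fun_scale_def algebra_simps)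

definition supp :: "('g \<Rightarrow> complex) \<Rightarrow> 'g set" where
  "supp f = {x. f x \<noteq> 0}"

definition Cc :: "('g, 'm) topgroupoid_scheme \<Rightarrow> ('g \<Rightarrow> complex) set" where
  "Cc G = {f. supp f \<subseteq> arrows G \<and> continuous_map (gtop G) euclidean f \<and>
    compactin (gtop G) (gtop G closure_of supp f)}"

definition locally_constant :: "'a topology \<Rightarrow> ('a \<Rightarrow> 'b) \<Rightarrow> bool" where
  "locally_constant X f \<longleftrightarrow>
    (\<forall>x\<in>topspace X. \<exists>U. openin X U \<and> x \<in> U \<and> f constant_on U)"

definition A_deg :: "('g, 'm) topgroupoid_scheme \<Rightarrow> ('g \<Rightarrow> 'h) \<Rightarrow> 'h \<Rightarrow> ('g \<Rightarrow> complex) set" where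
  "A_deg G c n = {f \<in> Cc G. supp f \<subseteq> fibre G c n \<and> locally_constant (gtop G) f}"

definition A_set ::
    "('g, 'm) topgroupoid_scheme \<Rightarrow> ('h, 'k) monoid_scheme \<Rightarrow> ('g \<Rightarrow> 'h) \<Rightarrow> ('g \<Rightarrow> complex) set"
  where "A_set G \<Gamma> c = cfun.span (\<Union>n\<in>carrier \<Gamma>. A_deg G c n)"

definition convol ::
    "('g, 'm) groupoid_scheme \<Rightarrow> ('g \<Rightarrow> complex) \<Rightarrow> ('g \<Rightarrow> complex) \<Rightarrow> 'g \<Rightarrow> complex" where
  "convol G f g = (\<lambda>\<gamma>. if \<gamma> \<in> arrows G
     then \<Sum>\<^sub>\<infinity>\<alpha>\<in>{\<alpha> \<in> arrows G. rng G \<alpha> = rng G \<gamma>}. f \<alpha> * g (cmp G (ginv G \<alpha>) \<gamma>)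
     else 0)"

definition A_alg ::
    "('g, 'm) topgroupoid_scheme \<Rightarrow> ('h, 'k) monoid_scheme \<Rightarrow> ('g \<Rightarrow> 'h) \<Rightarrow>
      (complex, 'g \<Rightarrow> complex) module" where
  "A_alg G \<Gamma> c = \<lparr>carrier = A_set G \<Gamma> c, monoid.mult = convol G, one = undefined,
     ring.zero = 0, add = (+), smult = fun_scale\<rparr>"

section \<open>Representations\<close>

text \<open>
  A family indexed by \<open>Bco_all G \<Gamma> c\<close> is a function on all sets of arrows whose values
  elsewhere are ignored.
\<close>

definition Bco_representation ::
    "('g, 'm) topgroupoid_scheme \<Rightarrow> ('h, 'k) monoid_scheme \<Rightarrow> ('g \<Rightarrow> 'h) \<Rightarrow>
      (complex, 'b, 'n) module_scheme \<Rightarrow> ('g set \<Rightarrow> 'b) \<Rightarrow> bool" where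
  "Bco_representation G \<Gamma> c B t \<longleftrightarrow>
    complex_algebra B \<and>
    (\<forall>U\<in>Bco_all G \<Gamma> c. t U \<in> carrier B) \<and>
    t {} = \<zero>\<^bsub>B\<^esub> \<and>
    (\<forall>U\<in>Bco_all G \<Gamma> c. \<forall>V\<in>Bco_all G \<Gamma> c. t U \<otimes>\<^bsub>B\<^esub> t V = t (set_cmp G U V)) \<and>
    (\<forall>n\<in>carrier \<Gamma>. \<forall>U\<in>Bco G c n. \<forall>V\<in>Bco G c n.
       U \<inter> V = {} \<longrightarrow> U \<union> V \<in> Bco G c n \<longrightarrow> t U \<oplus>\<^bsub>B\<^esub> t V = t (U \<union> V))"

end

theory Submission
  imports Defs
begin

text \<open>
  Since the source map is a local homeomorphism and the unit space has a clopen basis, the compact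
  open bisections inside a fibre of the cocycle form a basis of the topology, and they are closed
  under intersection, difference and product. A locally constant function with compact support in
  one fibre is therefore a finite combination of their indicators, and convolving indicators
  amounts to multiplying bisections.

  For the universal property everything reduces to showing that \<open>\<Sum> a\<^sub>i 1\<^bsub>U\<^sub>i\<^esub> = 0\<close> implies
  \<open>\<Sum> a\<^sub>i t\<^bsub>U\<^sub>i\<^esub> = 0\<close>. If \<open>\<Sum> a\<^sub>i 1\<^bsub>U\<^sub>i\<^esub>\<close> is constantly \<open>b\<close> on a bisection \<open>W\<close>, then
  \<open>\<Sum> a\<^sub>i t\<^bsub>U\<^sub>i \<inter> W\<^esub> = b t\<^bsub>W\<^esub>\<close>, by splitting \<open>W\<close> along one \<open>U\<^sub>i\<close> at a time. Applied with \<open>b = 0\<close> this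
  allows cutting the sets \<open>U\<^sub>i\<close> away one after the other: the part removed contributes zero, and
  nothing is left in the end.
\<close>

section \<open>Ample groupoids\<close>

lemma (in groupoid) composableI:
  "\<alpha> \<in> arrows G \<Longrightarrow> \<beta> \<in> arrows G \<Longrightarrow> src G \<alpha> = rng G \<beta> \<Longrightarrow> (\<alpha>, \<beta>) \<in> composable G"
  by (simp add: composable_def)

lemma (in groupoid) ginv_cmp_cancel:
  assumes "\<alpha> \<in> arrows G" "\<beta> \<in> arrows G" "src G \<alpha> = rng G \<beta>"
  shows "cmp G (ginv G \<alpha>) (cmp G \<alpha> \<beta>) = \<beta>"
  by (metis assms cmp_assoc composableI ginv_closed ginv_cmp rng_cmp_id src_ginv)

lemma (in groupoid) cmp_ginv_cancel:
  assumes "\<alpha> \<in> arrows G" "\<gamma> \<in> arrows G" "rng G \<alpha> = rng G \<gamma>"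
  shows "cmp G \<alpha> (cmp G (ginv G \<alpha>) \<gamma>) = \<gamma>"
  by (metis assms cmp_assoc cmp_ginv composableI ginv_closed rng_cmp_id rng_ginv src_ginv)

lemma (in groupoid) ginv_ginv:
  assumes "\<alpha> \<in> arrows G"
  shows "ginv G (ginv G \<alpha>) = \<alpha>"
  by (metis assms cmp_ginv_cancel cmp_ginv cmp_src ginv_closed rng_ginv src_ginv)

text \<open>The name is justified by \<open>exists_compact_open_bisection\<close>: the hypotheses
  give a basis of compact open bisections, which is the usual meaning of an ample groupoid.\<close>

locale ample_groupoid = topological_groupoid G
  for G :: "('g, 'm) topgroupoid_scheme" +
  assumes locally_compact: "locally_compact_space (gtop G)"
    and Hausdorff: "Hausdorff_space (gtop G)"
    and clopen_basis: "has_clopen_basis (unit_top G)"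
    and local_homeo_src: "local_homeomorphism (gtop G) (unit_top G) (src G)"
begin

section \<open>Open maps and small compact open bisections\<close>

lemma topspace_unit_top: "topspace (unit_top G) = units G"
  by (auto simp: unit_top_def topspace_gtop units_def)

lemma open_map_src: "open_map (gtop G) (unit_top G) (src G)"
  unfolding open_map_def
proof (intro allI impI)
  fix W assume W: "openin (gtop G) W"
  show "openin (unit_top G) (src G ` W)"
  proof (subst openin_subopen, intro ballI)
    fix u assume "u \<in> src G ` W"
    then obtain x where x: "x \<in> W" "u = src G x" by blast
    then have "x \<in> topspace (gtop G)" using W openin_subset by blast
    then obtain U where U: "openin (gtop G) U" "x \<in> U" "openin (unit_top G) (src G ` U)"
      "homeomorphic_map (subtopology (gtop G) U) (subtopology (unit_top G) (src G ` U)) (src G)"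
      using local_homeo_src unfolding local_homeomorphism_def by meson
    have "openin (subtopology (gtop G) U) (W \<inter> U)"
      using W by (auto simp: openin_subtopology)
    then have "openin (subtopology (unit_top G) (src G ` U)) (src G ` (W \<inter> U))"
      using U(4) by (meson homeomorphic_imp_open_map open_map_def)
    then have "openin (unit_top G) (src G ` (W \<inter> U))"
      using U(3) openin_open_subtopology by blast
    then show "\<exists>T. openin (unit_top G) T \<and> u \<in> T \<and> T \<subseteq> src G ` W"
      using x U(2) by blast
  qed
qed

text \<open>Inversion is an involution, so the image of \<open>W\<close> is also its preimage and
  continuity suffices.\<close>

lemma openin_ginv_image:
  assumes "openin (gtop G) W"
  shows "openin (gtop G) (ginv G ` W)"
proof -
  have "W \<subseteq> arrows G" using openin_subset[OF assms] topspace_gtop by simp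
  then have "ginv G ` W = {x \<in> topspace (gtop G). ginv G x \<in> W}"
    unfolding topspace_gtop by (force simp: ginv_ginv ginv_closed intro: rev_image_eqI)
  then show ?thesis
    using openin_continuous_map_preimage[OF continuous_ginv assms] by simp
qed

text \<open>Inversion exchanges range and source, which carries the openness of the source map over
  to the range map.\<close>

lemma open_map_rng: "open_map (gtop G) (unit_top G) (rng G)"
  unfolding open_map_def
proof (intro allI impI)
  fix W assume W: "openin (gtop G) W"
  then have "W \<subseteq> arrows G" using openin_subset topspace_gtop by fastforce
  then have "rng G ` W = src G ` ginv G ` W"
    by (auto simp: image_image src_ginv subset_iff intro!: image_cong)
  then show "openin (unit_top G) (rng G ` W)"
    using open_map_src openin_ginv_image[OF W] by (simp add: open_map_def)
qed

lemma open_injective_imp_homeomorphic: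
  assumes "openin (gtop G) U" "inj_on f U"
    and "open_map (gtop G) (unit_top G) f" "continuous_map (gtop G) (unit_top G) f"
  shows "homeomorphic_map (subtopology (gtop G) U) (subtopology (unit_top G) (f ` U)) f"
proof (rule bijective_open_imp_homeomorphic_map)
  have sub: "U \<subseteq> topspace (gtop G)" using assms(1) openin_subset by blast
  then have im: "f ` U \<subseteq> topspace (unit_top G)"
    using assms(4) continuous_map_image_subset_topspace by fastforce
  show "continuous_map (subtopology (gtop G) U) (subtopology (unit_top G) (f ` U)) f"
    using assms(4) by (auto simp: continuous_map_in_subtopology continuous_map_from_subtopology)
  show "open_map (subtopology (gtop G) U) (subtopology (unit_top G) (f ` U)) f"
    using assms(1,3) unfolding open_map_def
    by (metis image_mono openin_open_subtopology)
  show "f ` topspace (subtopology (gtop G) U) = topspace (subtopology (unit_top G) (f ` U))"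
    using sub im by (simp add: Int_absorb1)
  show "inj_on f (topspace (subtopology (gtop G) U))"
    using assms(2) sub by (simp add: Int_absorb1)
qed

text \<open>Range and source are continuous and open, so on an open set either one is a
  homeomorphism onto its image exactly when it is injective there. From here on bisections are
  handled through injectivity.\<close>

lemma open_bisection_iff:
  "open_bisection G U \<longleftrightarrow> openin (gtop G) U \<and> inj_on (rng G) U \<and> inj_on (src G) U"
proof
  assume *: "open_bisection G U"
  then have "topspace (subtopology (gtop G) U) = U"
    by (metis open_bisection_def openin_subset topspace_subtopology_subset)
  with * show "openin (gtop G) U \<and> inj_on (rng G) U \<and> inj_on (src G) U"
    unfolding open_bisection_def by (metis homeomorphic_imp_injective_map)
qed (simp add: open_bisection_def open_injective_imp_homeomorphic open_map_rng open_map_src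
    continuous_rng continuous_src)

lemma exists_src_injective_nbhd:
  assumes "\<alpha> \<in> arrows G"
  obtains U where "openin (gtop G) U" "\<alpha> \<in> U" "inj_on (src G) U"
proof -
  obtain U where U: "openin (gtop G) U" "\<alpha> \<in> U"
      "homeomorphic_map (subtopology (gtop G) U) (subtopology (unit_top G) (src G ` U)) (src G)"
    using assms local_homeo_src topspace_gtop unfolding local_homeomorphism_def by metis
  then have "inj_on (src G) U"
    by (metis homeomorphic_imp_injective_map openin_subset topspace_subtopology_subset)
  with U that show thesis by blast
qed

lemma exists_compact_open_bisection:
  assumes W: "openin (gtop G) W" "\<alpha> \<in> W"
  obtains U where "compactin (gtop G) U" "open_bisection G U" "\<alpha> \<in> U" "U \<subseteq> W"
proof -
  have \<alpha>: "\<alpha> \<in> arrows G" using W openin_subset topspace_gtop by blast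
  obtain U1 where U1: "openin (gtop G) U1" "\<alpha> \<in> U1" "inj_on (src G) U1"
    using exists_src_injective_nbhd[OF \<alpha>] .
  obtain U0 where U0: "openin (gtop G) U0" "ginv G \<alpha> \<in> U0" "inj_on (src G) U0"
    using exists_src_injective_nbhd[OF ginv_closed[OF \<alpha>]] .
  have U0_sub: "U0 \<subseteq> arrows G" using U0(1) openin_subset topspace_gtop by metis
  \<comment> \<open>Injectivity of the range map near \<alpha> comes from injectivity of the source
    map near the inverse of \<alpha>.\<close>
  have inj2: "inj_on (rng G) (ginv G ` U0)"
  proof (rule inj_onI)
    fix x y assume "x \<in> ginv G ` U0" "y \<in> ginv G ` U0" "rng G x = rng G y"
    then obtain a b where ab: "x = ginv G a" "y = ginv G b" "a \<in> U0" "b \<in> U0" by blast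
    with U0_sub \<open>rng G x = rng G y\<close> have "src G a = src G b"
      by (metis rng_ginv subsetD)
    with U0(3) ab show "x = y" by (auto dest: inj_onD)
  qed
  define N where "N = W \<inter> (U1 \<inter> ginv G ` U0)"
  have N: "openin (gtop G) N" "\<alpha> \<in> N"
    using W U1 U0 \<alpha> openin_ginv_image[OF U0(1)] unfolding N_def
    by (auto intro: rev_image_eqI simp: ginv_ginv)
  have "neighbourhood_base_of (\<lambda>C. compactin (gtop G) C \<and> closedin (gtop G) C) (gtop G)"
    using locally_compact_regular_space_neighbourhood_base locally_compact Hausdorff
      locally_compact_Hausdorff_imp_regular_space by blast
  then obtain V K where VK: "openin (gtop G) V" "compactin (gtop G) K" "closedin (gtop G) K"
      "\<alpha> \<in> V" "V \<subseteq> K" "K \<subseteq> N"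
    using N unfolding neighbourhood_base_of by metis
  have V_img: "openin (unit_top G) (src G ` V)"
    using VK(1) open_map_src by (auto simp: open_map_def)
  obtain \<B> where \<B>: "\<And>B. B \<in> \<B> \<Longrightarrow> openin (unit_top G) B \<and> closedin (unit_top G) B"
      "\<And>W. openin (unit_top G) W \<Longrightarrow> \<exists>\<C>\<subseteq>\<B>. \<Union>\<C> = W"
    using clopen_basis unfolding has_clopen_basis_def by (elim exE conjE) metis
  obtain \<C> where "\<C> \<subseteq> \<B>" "\<Union>\<C> = src G ` V"
    using \<B>(2)[OF V_img] by (elim exE conjE) (rule that)
  moreover from this VK(4) obtain B where "B \<in> \<C>" "src G \<alpha> \<in> B"
    by (metis UnionE imageI)
  ultimately have B: "openin (unit_top G) B" "closedin (unit_top G) B"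
      "src G \<alpha> \<in> B" "B \<subseteq> src G ` V"
    using \<B>(1) by auto
  define U where "U = K \<inter> {x \<in> topspace (gtop G). src G x \<in> B}"
  \<comment> \<open>An arrow of \<open>K\<close> with source in \<open>B\<close> shares its source
    with an arrow of \<open>V\<close>, and the source map is injective on \<open>N\<close>, so the
    two coincide. Hence \<open>U\<close> is compact when described through \<open>K\<close> and open
    when described through \<open>V\<close>.\<close>
  have "U = V \<inter> {x \<in> topspace (gtop G). src G x \<in> B}"
  proof -
    have "x \<in> V" if x: "x \<in> K" "src G x \<in> B" for x
    proof -
      obtain y where "y \<in> V" "src G y = src G x" using x B(4) by force
      with x VK(5,6) U1(3) show "x \<in> V"
        unfolding N_def by (metis IntE inj_onD subsetD)
    qed
    then show ?thesis using VK(5) unfolding U_def by blast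
  qed
  then have U_open: "openin (gtop G) U"
    using VK(1) openin_continuous_map_preimage[OF continuous_src B(1)] by (metis openin_Int)
  have U_compact: "compactin (gtop G) U"
    unfolding U_def using VK(2) closedin_continuous_map_preimage[OF continuous_src B(2)]
    by (rule compact_Int_closedin)
  have "U \<subseteq> N" using VK(6) U_def by blast
  then have "inj_on (rng G) U" "inj_on (src G) U"
    using inj2 U1(3) unfolding N_def by (meson Int_subset_iff inj_on_subset)+
  moreover have "\<alpha> \<in> U" using VK B \<alpha> unfolding U_def by (auto simp: topspace_gtop)
  moreover have "U \<subseteq> W" using \<open>U \<subseteq> N\<close> N_def by blast
  ultimately show thesis using that U_open U_compact open_bisection_iff by blast
qed

section \<open>Products of compact open bisections\<close>

lemma Hausdorff_unit_top: "Hausdorff_space (unit_top G)"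
  unfolding unit_top_def using Hausdorff by (rule Hausdorff_space_subtopology)

text \<open>The composable pairs are the preimage of the diagonal of the Hausdorff unit space, hence
  closed. So the product is the continuous image of a closed part of the compact set
  \<open>U \<times> V\<close>.\<close>

lemma compactin_set_cmp:
  assumes "compactin (gtop G) U" "compactin (gtop G) V"
  shows "compactin (gtop G) (set_cmp G U V)"
proof -
  let ?P = "prod_topology (gtop G) (gtop G)"
  have sub: "U \<subseteq> arrows G" "V \<subseteq> arrows G"
    using assms[THEN compactin_subset_topspace] by (simp_all add: topspace_gtop)
  have "continuous_map ?P (prod_topology (unit_top G) (unit_top G))
      (\<lambda>z. (src G (fst z), rng G (snd z)))"
    by (intro continuous_map_pairedI
        continuous_map_compose[OF continuous_map_fst continuous_src, unfolded o_def]
        continuous_map_compose[OF continuous_map_snd continuous_rng, unfolded o_def])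
  moreover have "closedin (prod_topology (unit_top G) (unit_top G))
      ((\<lambda>x. (x, x)) ` topspace (unit_top G))"
    using Hausdorff_unit_top by (simp add: Hausdorff_space_closedin_diagonal)
  ultimately have "closedin ?P {z \<in> topspace ?P.
      (src G (fst z), rng G (snd z)) \<in> (\<lambda>x. (x, x)) ` topspace (unit_top G)}"
    by (rule closedin_continuous_map_preimage)
  moreover have "{z \<in> topspace ?P.
      (src G (fst z), rng G (snd z)) \<in> (\<lambda>x. (x, x)) ` topspace (unit_top G)} = composable G"
    by (auto simp: topspace_gtop composable_def image_iff topspace_unit_top src_units rng_units)
  ultimately have closed: "closedin ?P (composable G)" by simp
  have "compactin ?P (U \<times> V)" using assms by (simp add: compactin_Times)
  then have "compactin (subtopology ?P (composable G)) (composable G \<inter> U \<times> V)"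
    using closed closed_Int_compactin compactin_subtopology by blast
  then have "compactin (gtop G) ((\<lambda>(\<alpha>, \<beta>). cmp G \<alpha> \<beta>) ` (composable G \<inter> U \<times> V))"
    using continuous_cmp image_compactin by blast
  moreover have "(\<lambda>(\<alpha>, \<beta>). cmp G \<alpha> \<beta>) ` (composable G \<inter> U \<times> V) = set_cmp G U V"
    using sub by (force simp: set_cmp_def composable_def image_iff)
  ultimately show ?thesis by simp
qed

text \<open>
  The product is a preimage: writing \<open>g\<close> for the inverse of the range map on \<open>U\<close>, an arrow
  \<open>\<gamma>\<close> with range in \<open>rng G ` U\<close> lies in \<open>UV\<close> iff \<open>(g (rng G \<gamma>))\<inverse> \<gamma> \<in> V\<close>.
\<close>

lemma openin_set_cmp:
  assumes U: "open_bisection G U" and V: "openin (gtop G) V"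
  shows "openin (gtop G) (set_cmp G U V)"
proof -
  have U_open: "openin (gtop G) U" using U by (simp add: open_bisection_def)
  have sub: "U \<subseteq> arrows G" "V \<subseteq> arrows G"
    using U_open V openin_subset topspace_gtop by blast+
  have rU: "openin (unit_top G) (rng G ` U)"
    using open_map_rng U_open by (simp add: open_map_def)
  obtain g where g: "homeomorphic_maps (subtopology (gtop G) U)
      (subtopology (unit_top G) (rng G ` U)) (rng G) g"
    using U unfolding open_bisection_def homeomorphic_map_maps by blast
  have g_rng: "g (rng G x) = x" if "x \<in> U" for x
    using g that sub by (auto simp: homeomorphic_maps_def topspace_gtop)
  define P where "P = {x \<in> topspace (gtop G). rng G x \<in> rng G ` U}"
  have P: "openin (gtop G) P"
    unfolding P_def using continuous_rng rU by (rule openin_continuous_map_preimage)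
  let ?P = "subtopology (gtop G) P"
  have "continuous_map ?P (subtopology (unit_top G) (rng G ` U)) (rng G)"
    using continuous_rng
    by (auto simp: continuous_map_in_subtopology continuous_map_from_subtopology P_def)
  moreover have "continuous_map (subtopology (unit_top G) (rng G ` U)) (gtop G) g"
    using g by (meson continuous_map_into_fulltopology homeomorphic_maps_def)
  ultimately have "continuous_map ?P (gtop G) (g \<circ> rng G)"
    by (rule continuous_map_compose)
  then have "continuous_map ?P (gtop G) (ginv G \<circ> (g \<circ> rng G))"
    using continuous_ginv by (rule continuous_map_compose)
  then have "continuous_map ?P (prod_topology (gtop G) (gtop G)) (\<lambda>x. (ginv G (g (rng G x)), x))"
    by (intro continuous_map_pairedI) (simp_all add: o_def continuous_map_from_subtopology)
  moreover have "(ginv G (g (rng G x)), x) \<in> composable G" if "x \<in> P" for x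
    using that sub g_rng
    by (auto simp: P_def topspace_gtop composable_def ginv_closed src_ginv subset_iff)
  ultimately have "continuous_map ?P (subtopology (prod_topology (gtop G) (gtop G)) (composable G))
      (\<lambda>x. (ginv G (g (rng G x)), x))"
    by (auto intro!: continuous_map_into_subtopology)
  then have "continuous_map ?P (gtop G)
      ((\<lambda>(\<alpha>, \<beta>). cmp G \<alpha> \<beta>) \<circ> (\<lambda>x. (ginv G (g (rng G x)), x)))"
    using continuous_cmp by (rule continuous_map_compose)
  from openin_continuous_map_preimage[OF this V]
  have "openin ?P {x \<in> topspace ?P. cmp G (ginv G (g (rng G x))) x \<in> V}"
    by simp
  then have "openin (gtop G) {x \<in> topspace ?P. cmp G (ginv G (g (rng G x))) x \<in> V}"
    using P openin_open_subtopology by blast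
  moreover have "{x \<in> topspace ?P. cmp G (ginv G (g (rng G x))) x \<in> V} = set_cmp G U V"
  proof (rule Set.set_eqI, rule iffI)
    fix x assume "x \<in> {x \<in> topspace ?P. cmp G (ginv G (g (rng G x))) x \<in> V}"
    then obtain \<alpha> where x: "x \<in> arrows G" "\<alpha> \<in> U" "rng G x = rng G \<alpha>" "cmp G (ginv G \<alpha>) x \<in> V"
      using g_rng by (auto simp: P_def topspace_gtop)
    moreover have "\<alpha> \<in> arrows G" using x sub by blast
    ultimately have "x = cmp G \<alpha> (cmp G (ginv G \<alpha>) x)" "src G \<alpha> = rng G (cmp G (ginv G \<alpha>) x)"
      by (simp_all add: cmp_ginv_cancel rng_cmp composable_def ginv_closed src_ginv rng_ginv)
    with x show "x \<in> set_cmp G U V" unfolding set_cmp_def by blast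
  next
    fix x assume "x \<in> set_cmp G U V"
    then obtain \<alpha> \<beta> where x: "x = cmp G \<alpha> \<beta>" "\<alpha> \<in> U" "\<beta> \<in> V" "src G \<alpha> = rng G \<beta>"
      unfolding set_cmp_def by blast
    with sub have "(\<alpha>, \<beta>) \<in> composable G" by (auto simp: composable_def)
    with x sub show "x \<in> {x \<in> topspace ?P. cmp G (ginv G (g (rng G x))) x \<in> V}"
      by (auto simp: P_def topspace_gtop cmp_closed rng_cmp g_rng ginv_cmp_cancel subset_iff)
  qed
  ultimately show ?thesis by simp
qed

lemma open_bisection_set_cmp:
  assumes U: "open_bisection G U" and V: "open_bisection G V"
  shows "open_bisection G (set_cmp G U V)"
proof -
  have inj: "inj_on (rng G) U" "inj_on (src G) U" "inj_on (rng G) V" "inj_on (src G) V"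
    and V_open: "openin (gtop G) V" and U_open: "openin (gtop G) U"
    using U V by (simp_all add: open_bisection_iff)
  have sub: "U \<subseteq> arrows G" "V \<subseteq> arrows G"
    using U_open V_open openin_subset topspace_gtop by blast+
  have "x = y" if x: "x \<in> set_cmp G U V" and y: "y \<in> set_cmp G U V"
    and eq: "rng G x = rng G y \<or> src G x = src G y" for x y
  proof -
    obtain \<alpha> \<beta> where x: "x = cmp G \<alpha> \<beta>" "\<alpha> \<in> U" "\<beta> \<in> V" "src G \<alpha> = rng G \<beta>"
      using x unfolding set_cmp_def by blast
    obtain \<alpha>' \<beta>' where y: "y = cmp G \<alpha>' \<beta>'" "\<alpha>' \<in> U" "\<beta>' \<in> V" "src G \<alpha>' = rng G \<beta>'"
      using y unfolding set_cmp_def by blast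
    have "(\<alpha>, \<beta>) \<in> composable G" "(\<alpha>', \<beta>') \<in> composable G"
      using x y sub by (auto simp: composable_def)
    with eq x(1) y(1) have "rng G \<alpha> = rng G \<alpha>' \<or> src G \<beta> = src G \<beta>'"
      by (simp add: rng_cmp src_cmp)
    \<comment> \<open>If the ranges agree, injectivity on \<open>U\<close> identifies \<alpha> with
      \<alpha>'; then \<beta> and \<beta>' have the same range, namely the common source, and agree
      as well. Equal sources give the same from the other end.\<close>
    then have "\<alpha> = \<alpha>' \<and> \<beta> = \<beta>'"
      using x y inj by (metis inj_onD)
    then show ?thesis using x y by simp
  qed
  then show ?thesis
    using openin_set_cmp[OF U V_open] by (auto simp: open_bisection_iff intro!: inj_onI)
qed

end

section \<open>Linear combinations in complex algebras\<close>

lemma complex_field_simps [simp]: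
  "carrier complex_field = UNIV" "\<zero>\<^bsub>complex_field\<^esub> = 0" "\<one>\<^bsub>complex_field\<^esub> = 1"
  "a \<oplus>\<^bsub>complex_field\<^esub> b = a + b" "a \<otimes>\<^bsub>complex_field\<^esub> b = a * b"
  by (simp_all add: complex_field_def)

text \<open>A formal combination is a list of coefficients and indices, with repetitions allowed.
  Keeping it apart from its value lets one list be evaluated both at the indicators in
  \<open>A_alg G \<Gamma> c\<close> and at a representation \<open>t\<close> in
  \<open>B\<close>.\<close>

primrec lin_comb ::
    "(complex, 'b, 'm) module_scheme \<Rightarrow> ('u \<Rightarrow> 'b) \<Rightarrow> (complex \<times> 'u) list \<Rightarrow> 'b" where
  "lin_comb B t [] = \<zero>\<^bsub>B\<^esub>"
| "lin_comb B t (p # ps) = (fst p \<odot>\<^bsub>B\<^esub> t (snd p)) \<oplus>\<^bsub>B\<^esub> lin_comb B t ps"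

definition lin_comb_scale :: "complex \<Rightarrow> (complex \<times> 'u) list \<Rightarrow> (complex \<times> 'u) list" where
  "lin_comb_scale k ps = map (\<lambda>(a, U). (k * a, U)) ps"

text \<open>The bilinear extension of \<open>m\<close> to formal combinations, as in a semigroup
  algebra; it is used with \<open>m = set_cmp G\<close>.\<close>

definition lin_comb_mult ::
    "('u \<Rightarrow> 'u \<Rightarrow> 'u) \<Rightarrow> (complex \<times> 'u) list \<Rightarrow> (complex \<times> 'u) list \<Rightarrow> (complex \<times> 'u) list" where
  "lin_comb_mult m ps qs = concat (map (\<lambda>(a, U). map (\<lambda>(b, V). (a * b, m U V)) qs) ps)"

lemma snd_lin_comb_scale [simp]: "snd ` set (lin_comb_scale k ps) = snd ` set ps"
  by (force simp: lin_comb_scale_def)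

lemma snd_lin_comb_mult:
  assumes "snd ` set ps \<subseteq> S" "snd ` set qs \<subseteq> S" "\<And>U V. U \<in> S \<Longrightarrow> V \<in> S \<Longrightarrow> m U V \<in> S"
  shows "snd ` set (lin_comb_mult m ps qs) \<subseteq> S"
  using assms by (auto simp: lin_comb_mult_def split_beta image_subset_iff)

lemma lin_comb_cong:
  "(\<And>U. U \<in> snd ` set ps \<Longrightarrow> t U = t' U) \<Longrightarrow> lin_comb B t ps = lin_comb B t' ps"
  by (induction ps) auto

context complex_algebra
begin

text \<open>Zero is the multiple of itself by the scalar 0, and this scalar can be moved out of the
  product.\<close>

lemma zero_mult: "x \<in> carrier B \<Longrightarrow> \<zero>\<^bsub>B\<^esub> \<otimes>\<^bsub>B\<^esub> x = \<zero>\<^bsub>B\<^esub>"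
  using smult_mult_left[of "\<zero>\<^bsub>B\<^esub>" x 0] smult_l_null[of "\<zero>\<^bsub>B\<^esub> \<otimes>\<^bsub>B\<^esub> x"] smult_l_null[of "\<zero>\<^bsub>B\<^esub>"]
  by (simp add: mult_closed)

lemma mult_zero: "x \<in> carrier B \<Longrightarrow> x \<otimes>\<^bsub>B\<^esub> \<zero>\<^bsub>B\<^esub> = \<zero>\<^bsub>B\<^esub>"
  using smult_mult_right[of x "\<zero>\<^bsub>B\<^esub>" 0] smult_l_null[of "x \<otimes>\<^bsub>B\<^esub> \<zero>\<^bsub>B\<^esub>"] smult_l_null[of "\<zero>\<^bsub>B\<^esub>"]
  by (simp add: mult_closed)

lemma lin_comb_closed:
  assumes "snd ` set ps \<subseteq> S" "t ` S \<subseteq> carrier B"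
  shows "lin_comb B t ps \<in> carrier B"
  using assms(1) by (induction ps) (use assms(2) in auto)

lemma lin_comb_append:
  assumes "snd ` set ps \<subseteq> S" "snd ` set qs \<subseteq> S" "t ` S \<subseteq> carrier B"
  shows "lin_comb B t (ps @ qs) = lin_comb B t ps \<oplus>\<^bsub>B\<^esub> lin_comb B t qs"
  using assms(1)
proof (induction ps)
  case Nil
  then show ?case using lin_comb_closed[OF assms(2,3)] by simp
next
  case (Cons p ps)
  then have "t (snd p) \<in> carrier B" "lin_comb B t ps \<in> carrier B"
    using assms(3) lin_comb_closed[OF _ assms(3)] by auto
  with Cons lin_comb_closed[OF assms(2,3)] show ?case by (simp add: M.a_assoc)
qed

lemma lin_comb_scale:
  assumes "snd ` set ps \<subseteq> S" "t ` S \<subseteq> carrier B"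
  shows "lin_comb B t (lin_comb_scale k ps) = k \<odot>\<^bsub>B\<^esub> lin_comb B t ps"
  using assms(1)
proof (induction ps)
  case Nil
  then show ?case by (simp add: lin_comb_scale_def smult_r_null)
next
  case (Cons p ps)
  then have "t (snd p) \<in> carrier B" "lin_comb B t ps \<in> carrier B"
    using assms(2) lin_comb_closed[OF _ assms(2)] by auto
  with Cons show ?case
    using smult_assoc1[of k "fst p"]
    by (simp add: lin_comb_scale_def smult_r_distr split_beta)
qed

lemma lin_comb_add:
  assumes "snd ` set ps \<subseteq> S" "s ` S \<subseteq> carrier B" "t ` S \<subseteq> carrier B"
  shows "lin_comb B (\<lambda>U. s U \<oplus>\<^bsub>B\<^esub> t U) ps = lin_comb B s ps \<oplus>\<^bsub>B\<^esub> lin_comb B t ps"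
  using assms(1)
proof (induction ps)
  case (Cons p ps)
  then have "s (snd p) \<in> carrier B" "lin_comb B s ps \<in> carrier B"
      "t (snd p) \<in> carrier B" "lin_comb B t ps \<in> carrier B"
    using assms(2,3) lin_comb_closed[OF _ assms(2)] lin_comb_closed[OF _ assms(3)] by auto
  with Cons show ?case by (simp add: smult_r_distr M.a_ac)
qed simp

lemma lin_comb_zero:
  assumes "\<And>U. U \<in> snd ` set ps \<Longrightarrow> t U = \<zero>\<^bsub>B\<^esub>"
  shows "lin_comb B t ps = \<zero>\<^bsub>B\<^esub>"
  using assms by (induction ps) (simp_all add: smult_r_null)

lemma lin_comb_mult:
  assumes ps: "snd ` set ps \<subseteq> S" and qs: "snd ` set qs \<subseteq> S" and t: "t ` S \<subseteq> carrier B"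
    and m: "\<And>U V. U \<in> S \<Longrightarrow> V \<in> S \<Longrightarrow> m U V \<in> S"
      "\<And>U V. U \<in> S \<Longrightarrow> V \<in> S \<Longrightarrow> t U \<otimes>\<^bsub>B\<^esub> t V = t (m U V)"
  shows "lin_comb B t (lin_comb_mult m ps qs) = lin_comb B t ps \<otimes>\<^bsub>B\<^esub> lin_comb B t qs"
proof -
  \<comment> \<open>Distributivity on the right comes first, for one term of the left factor; the
    induction on \<open>ps\<close> then distributes on the left.\<close>
  have single: "lin_comb B t (map (\<lambda>(b, V). (a * b, m U V)) qs)
      = (a \<odot>\<^bsub>B\<^esub> t U) \<otimes>\<^bsub>B\<^esub> lin_comb B t qs" if U: "U \<in> S" for a U
    using qs
  proof (induction qs)
    case Nil
    then show ?case using U t by (simp add: mult_zero image_subset_iff)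
  next
    case (Cons q qs)
    then have in_B: "t U \<in> carrier B" "t (snd q) \<in> carrier B" "lin_comb B t qs \<in> carrier B"
      using t U lin_comb_closed[OF _ t] by auto
    have "(a * fst q) \<odot>\<^bsub>B\<^esub> t (m U (snd q)) = (a \<odot>\<^bsub>B\<^esub> t U) \<otimes>\<^bsub>B\<^esub> (fst q \<odot>\<^bsub>B\<^esub> t (snd q))"
      using Cons.prems U in_B smult_assoc1[of "fst q" a "t U \<otimes>\<^bsub>B\<^esub> t (snd q)"]
      by (simp add: m(2)[symmetric] smult_mult_left smult_mult_right mult_closed mult.commute)
    with Cons in_B show ?case by (simp add: mult_distr_right split_beta)
  qed
  show ?thesis
    using ps
  proof (induction ps)
    case Nil
    then show ?case using lin_comb_closed[OF qs t] by (simp add: lin_comb_mult_def zero_mult)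
  next
    case (Cons p ps)
    then have in_B: "t (snd p) \<in> carrier B" "lin_comb B t ps \<in> carrier B"
      using t lin_comb_closed[OF _ t] by auto
    have "lin_comb_mult m (p # ps) qs
        = map (\<lambda>(b, V). (fst p * b, m (snd p) V)) qs @ lin_comb_mult m ps qs"
      by (simp add: lin_comb_mult_def split_beta)
    moreover have "snd ` set (map (\<lambda>(b, V). (fst p * b, m (snd p) V)) qs) \<subseteq> S"
      using Cons.prems qs m(1) by (auto simp: split_beta image_subset_iff)
    moreover have "snd ` set (lin_comb_mult m ps qs) \<subseteq> S"
      using Cons.prems qs m(1) by (intro snd_lin_comb_mult) auto
    ultimately show ?case
      using Cons in_B lin_comb_closed[OF qs t]
      by (simp add: lin_comb_append[OF _ _ t] single mult_distr_left)
  qed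
qed

end

section \<open>Finitely additive functions on a ring of sets\<close>

text \<open>Closure under unions is not demanded, because a union of two bisections need not be a
  bisection. Additivity is therefore phrased as the splitting of a member \<open>U\<close> along
  another member \<open>W\<close>.\<close>

locale additive_set_function = complex_algebra B
  for B :: "(complex, 'b, 'm) module_scheme" +
  fixes \<R> :: "'x set set" and t :: "'x set \<Rightarrow> 'b"
  assumes Int_closed: "U \<in> \<R> \<Longrightarrow> W \<in> \<R> \<Longrightarrow> U \<inter> W \<in> \<R>"
    and Diff_closed: "U \<in> \<R> \<Longrightarrow> W \<in> \<R> \<Longrightarrow> U - W \<in> \<R>"
    and values_closed: "t ` \<R> \<subseteq> carrier B"
    and value_empty: "t {} = \<zero>\<^bsub>B\<^esub>"
    and additive: "U \<in> \<R> \<Longrightarrow> W \<in> \<R> \<Longrightarrow> t U = t (U \<inter> W) \<oplus>\<^bsub>B\<^esub> t (U - W)"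
begin

text \<open>The union of \<open>D\<close> may lie outside \<open>\<R>\<close>, so its members are
  removed one at a time.\<close>

lemma Diff_Union_closed:
  assumes "finite D" "D \<subseteq> \<R>" "U \<in> \<R>"
  shows "U - \<Union>D \<in> \<R>"
  using assms
proof (induction D)
  case (insert W D)
  then have "(U - \<Union>D) - W \<in> \<R>" by (simp add: Diff_closed)
  moreover have "(U - \<Union>D) - W = U - \<Union>(insert W D)" by blast
  ultimately show ?case by metis
qed simp

text \<open>The induction generalises \<open>W\<close> and \<open>b\<close>: splitting
  \<open>W\<close> along the first set leaves a shorter list that is again constant on each of the
  two pieces, with different constants.\<close>

lemma lin_comb_constant_on:
  assumes "snd ` set ps \<subseteq> \<R>" "W \<in> \<R>"
    and "\<And>x. x \<in> W \<Longrightarrow> (\<Sum>(a, U)\<leftarrow>ps. a * indicator U x) = b"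
  shows "lin_comb B (\<lambda>U. t (U \<inter> W)) ps = b \<odot>\<^bsub>B\<^esub> t W"
  using assms
proof (induction ps arbitrary: W b)
  case Nil
  show ?case
  \<comment> \<open>On an empty \<open>W\<close> the hypothesis leaves \<open>b\<close> arbitrary,
    but then \<open>t W\<close> is zero; otherwise the empty sum forces
    \<open>b = 0\<close>.\<close>
  proof (cases "W = {}")
    case True
    then show ?thesis by (simp add: value_empty smult_r_null)
  next
    case False
    then have "b = 0" using Nil by force
    then show ?thesis
      using Nil values_closed smult_l_null[of "t W"] by (simp add: image_subset_iff)
  qed
next
  case (Cons p ps)
  obtain a V where p: "p = (a, V)" by force
  have V: "V \<in> \<R>" and ps: "snd ` set ps \<subseteq> \<R>" using Cons.prems p by auto
  let ?W1 = "W \<inter> V" and ?W2 = "W - V"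
  have W: "?W1 \<in> \<R>" "?W2 \<in> \<R>" "W \<in> \<R>"
    using Cons.prems V by (simp_all add: Int_closed Diff_closed)
  have tW: "t ?W1 \<in> carrier B" "t ?W2 \<in> carrier B" "t W \<in> carrier B"
    using W values_closed by auto
  have in_B: "(\<lambda>U. t (U \<inter> Y)) ` \<R> \<subseteq> carrier B" if "Y \<in> \<R>" for Y
    using values_closed Int_closed that by auto
  \<comment> \<open>On \<open>W \<inter> V\<close> the first term contributes \<open>a\<close>, so
    the remaining terms add up to \<open>b - a\<close>; on \<open>W - V\<close> it contributes
    nothing.\<close>
  have 1: "lin_comb B (\<lambda>U. t (U \<inter> ?W1)) ps = (b - a) \<odot>\<^bsub>B\<^esub> t ?W1"
    using Cons.prems(3) p by (intro Cons.IH ps W) (force simp: algebra_simps)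
  have 2: "lin_comb B (\<lambda>U. t (U \<inter> ?W2)) ps = b \<odot>\<^bsub>B\<^esub> t ?W2"
    using Cons.prems(3) p by (intro Cons.IH ps W) force
  have "t (U \<inter> W) = t (U \<inter> ?W1) \<oplus>\<^bsub>B\<^esub> t (U \<inter> ?W2)" if "U \<in> \<R>" for U
    using additive[of "U \<inter> W" V] that V W Int_closed
    by (simp add: Int_assoc Int_Diff)
  then have "lin_comb B (\<lambda>U. t (U \<inter> W)) ps
      = lin_comb B (\<lambda>U. t (U \<inter> ?W1) \<oplus>\<^bsub>B\<^esub> t (U \<inter> ?W2)) ps"
    using ps by (intro lin_comb_cong) blast
  also have "\<dots> = (b - a) \<odot>\<^bsub>B\<^esub> t ?W1 \<oplus>\<^bsub>B\<^esub> b \<odot>\<^bsub>B\<^esub> t ?W2"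
    using lin_comb_add[OF ps in_B[OF W(1)] in_B[OF W(2)]] 1 2 by simp
  finally have "lin_comb B (\<lambda>U. t (U \<inter> W)) (p # ps)
      = a \<odot>\<^bsub>B\<^esub> t ?W1 \<oplus>\<^bsub>B\<^esub> ((b - a) \<odot>\<^bsub>B\<^esub> t ?W1 \<oplus>\<^bsub>B\<^esub> b \<odot>\<^bsub>B\<^esub> t ?W2)"
    by (simp add: p Int_commute)
  also have "\<dots> = (a \<odot>\<^bsub>B\<^esub> t ?W1 \<oplus>\<^bsub>B\<^esub> (b - a) \<odot>\<^bsub>B\<^esub> t ?W1) \<oplus>\<^bsub>B\<^esub> b \<odot>\<^bsub>B\<^esub> t ?W2"
    using tW by (simp add: M.a_assoc)
  also have "a \<odot>\<^bsub>B\<^esub> t ?W1 \<oplus>\<^bsub>B\<^esub> (b - a) \<odot>\<^bsub>B\<^esub> t ?W1 = b \<odot>\<^bsub>B\<^esub> t ?W1"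
    using smult_l_distr[of a "b - a" "t ?W1"] tW by simp
  also have "b \<odot>\<^bsub>B\<^esub> t ?W1 \<oplus>\<^bsub>B\<^esub> b \<odot>\<^bsub>B\<^esub> t ?W2 = b \<odot>\<^bsub>B\<^esub> t W"
    using additive[OF W(3) V] tW by (simp add: smult_r_distr)
  finally show ?case .
qed

lemma lin_comb_eq_zero:
  assumes ps: "snd ` set ps \<subseteq> \<R>" and zero: "\<And>x. (\<Sum>(a, U)\<leftarrow>ps. a * indicator U x) = 0"
  shows "lin_comb B t ps = \<zero>\<^bsub>B\<^esub>"
proof -
  \<comment> \<open>Invariant of the cutting: deleting finitely many members of \<open>\<R>\<close>
    from every set in the list leaves the value unchanged. Deleting all the sets of the list itself
    then empties every entry.\<close>
  have "lin_comb B t ps = lin_comb B (\<lambda>U. t (U - \<Union>D)) ps" if "finite D" "D \<subseteq> \<R>" for D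
    using that
  proof (induction D)
    case (insert W D)
    \<comment> \<open>The set \<open>?Y\<close> is the part of \<open>W\<close> not deleted so far.
      It is again a member of \<open>\<R>\<close>, so \<open>lin_comb_constant_on\<close> with
      \<open>b = 0\<close> shows that the part cut away contributes zero.\<close>
    let ?Y = "W - \<Union>D" and ?D = "insert W D"
    have Y: "?Y \<in> \<R>" using insert Diff_Union_closed by simp
    have split: "t (U - \<Union>D) = t (U \<inter> ?Y) \<oplus>\<^bsub>B\<^esub> t (U - \<Union>?D)" if "U \<in> \<R>" for U
    proof -
      have "t (U - \<Union>D) = t ((U - \<Union>D) \<inter> W) \<oplus>\<^bsub>B\<^esub> t ((U - \<Union>D) - W)"
        using that insert Diff_Union_closed by (intro additive) auto
      moreover have "(U - \<Union>D) \<inter> W = U \<inter> ?Y" "(U - \<Union>D) - W = U - \<Union>?D" by blast+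
      ultimately show ?thesis by metis
    qed
    have in_B: "(\<lambda>U. t (U \<inter> ?Y)) ` \<R> \<subseteq> carrier B" "(\<lambda>U. t (U - \<Union>?D)) ` \<R> \<subseteq> carrier B"
      using values_closed Int_closed Y Diff_Union_closed[of ?D] insert by (auto simp del: Union_insert)
    have "lin_comb B t ps = lin_comb B (\<lambda>U. t (U - \<Union>D)) ps" using insert by simp
    also have "\<dots> = lin_comb B (\<lambda>U. t (U \<inter> ?Y) \<oplus>\<^bsub>B\<^esub> t (U - \<Union>?D)) ps"
      using ps split by (intro lin_comb_cong) blast
    also have "\<dots> = lin_comb B (\<lambda>U. t (U \<inter> ?Y)) ps \<oplus>\<^bsub>B\<^esub> lin_comb B (\<lambda>U. t (U - \<Union>?D)) ps"
      using ps in_B by (rule lin_comb_add)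
    also have "lin_comb B (\<lambda>U. t (U \<inter> ?Y)) ps = \<zero>\<^bsub>B\<^esub>"
      using lin_comb_constant_on[OF ps Y zero] values_closed Y smult_l_null[of "t ?Y"] by auto
    finally show ?case
      using lin_comb_closed[OF ps in_B(2)] by simp
  qed simp
  from this[of "snd ` set ps"] ps
  have "lin_comb B t ps = lin_comb B (\<lambda>U. t (U - \<Union>(snd ` set ps))) ps" by simp
  also have "\<dots> = \<zero>\<^bsub>B\<^esub>"
  proof (rule lin_comb_zero)
    fix U assume "U \<in> snd ` set ps"
    then have "U - \<Union>(snd ` set ps) = {}" by blast
    then show "t (U - \<Union>(snd ` set ps)) = \<zero>\<^bsub>B\<^esub>" by (metis value_empty)
  qed
  finally show ?thesis .
qed

text \<open>This is what makes the universal map well defined: the value of a formal combination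
  under \<open>t\<close> depends only on the function it represents.\<close>

lemma lin_comb_eqI:
  assumes ps: "snd ` set ps \<subseteq> \<R>" and qs: "snd ` set qs \<subseteq> \<R>"
    and eq: "\<And>x. (\<Sum>(a, U)\<leftarrow>ps. a * indicator U x) = (\<Sum>(a, U)\<leftarrow>qs. a * indicator U x)"
  shows "lin_comb B t ps = lin_comb B t qs"
proof -
  \<comment> \<open>Appending the negative of \<open>qs\<close> to \<open>ps\<close> and to
    \<open>qs\<close> gives two lists representing the zero function; the common summand is then
    cancelled in \<open>B\<close>.\<close>
  let ?n = "lin_comb_scale (-1) qs"
  have in_B: "lin_comb B t ps \<in> carrier B" "lin_comb B t qs \<in> carrier B"
    using lin_comb_closed values_closed ps qs by blast+
  have "(\<Sum>(a, U)\<leftarrow>?n. a * indicator U x) = - (\<Sum>(a, U)\<leftarrow>qs. a * indicator U x)" for x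
    by (induction qs) (auto simp: lin_comb_scale_def)
  then have "lin_comb B t (ps @ ?n) = \<zero>\<^bsub>B\<^esub>"
    using ps qs eq by (intro lin_comb_eq_zero) (simp_all add: image_Un)
  moreover have "lin_comb B t (qs @ ?n) = \<zero>\<^bsub>B\<^esub>"
    using ps qs \<open>\<And>x. (\<Sum>(a, U)\<leftarrow>?n. a * indicator U x) = _ x\<close>
    by (intro lin_comb_eq_zero) (simp_all add: image_Un)
  ultimately have "lin_comb B t ps \<oplus>\<^bsub>B\<^esub> lin_comb B t ?n = lin_comb B t qs \<oplus>\<^bsub>B\<^esub> lin_comb B t ?n"
    using ps qs by (simp add: lin_comb_append[OF _ _ values_closed])
  moreover have "lin_comb B t ?n \<in> carrier B"
    using qs by (simp add: lin_comb_closed[OF _ values_closed])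
  ultimately show ?thesis using in_B by simp
qed

end

section \<open>The convolution algebra\<close>

text \<open>Convolution is defined by \<open>infsum\<close>, which is 0 on families that are not
  summable. For a row finite left factor each such sum has only finitely many non-zero terms, so
  convolution is additive there.\<close>

definition row_finite :: "('g, 'm) groupoid_scheme \<Rightarrow> ('g \<Rightarrow> complex) \<Rightarrow> bool" where
  "row_finite G f \<longleftrightarrow> (\<forall>u. finite {\<alpha> \<in> arrows G. rng G \<alpha> = u \<and> f \<alpha> \<noteq> 0})"

lemma row_finite_zero: "row_finite G 0"
  by (simp add: row_finite_def)

lemma row_finite_add:
  assumes "row_finite G f" "row_finite G g"
  shows "row_finite G (f + g)"
  unfolding row_finite_def
proof
  fix u
  have "{\<alpha> \<in> arrows G. rng G \<alpha> = u \<and> (f + g) \<alpha> \<noteq> 0} \<subseteq>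
      {\<alpha> \<in> arrows G. rng G \<alpha> = u \<and> f \<alpha> \<noteq> 0} \<union> {\<alpha> \<in> arrows G. rng G \<alpha> = u \<and> g \<alpha> \<noteq> 0}"
    by auto
  then show "finite {\<alpha> \<in> arrows G. rng G \<alpha> = u \<and> (f + g) \<alpha> \<noteq> 0}"
    using assms unfolding row_finite_def by (meson finite_UnI finite_subset)
qed

lemma row_finite_scale:
  assumes "row_finite G f"
  shows "row_finite G (fun_scale a f)"
  using assms unfolding row_finite_def fun_scale_def
  by (auto intro: finite_subset[rotated])

text \<open>Injectivity of the range map leaves at most one arrow of \<open>U\<close> over each
  unit.\<close>

lemma row_finite_indicator:
  assumes "inj_on (rng G) U"
  shows "row_finite G (indicator U)"
  unfolding row_finite_def
proof
  fix u
  have "inj_on (rng G) {\<alpha> \<in> arrows G. rng G \<alpha> = u \<and> indicator U \<alpha> \<noteq> (0::complex)}"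
    using assms by (rule inj_on_subset) (auto simp: indicator_def split: if_splits)
  moreover have "rng G ` {\<alpha> \<in> arrows G. rng G \<alpha> = u \<and> indicator U \<alpha> \<noteq> (0::complex)} \<subseteq> {u}"
    by auto
  ultimately show "finite {\<alpha> \<in> arrows G. rng G \<alpha> = u \<and> indicator U \<alpha> \<noteq> (0::complex)}"
    by (meson finite.emptyI finite_insert inj_on_finite)
qed

lemma row_finite_summable:
  assumes "row_finite G f"
  shows "(\<lambda>\<alpha>. f \<alpha> * h \<alpha>) summable_on {\<alpha> \<in> arrows G. rng G \<alpha> = u}"
proof -
  have "(\<lambda>\<alpha>. f \<alpha> * h \<alpha>) summable_on {\<alpha> \<in> arrows G. rng G \<alpha> = u \<and> f \<alpha> \<noteq> 0}"
    using assms by (simp add: row_finite_def)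
  then show ?thesis
    by (subst summable_on_cong_neutral[where T = "{\<alpha> \<in> arrows G. rng G \<alpha> = u \<and> f \<alpha> \<noteq> 0}"
          and g = "\<lambda>\<alpha>. f \<alpha> * h \<alpha>"]) auto
qed

lemma convol_add_left:
  assumes "row_finite G f" "row_finite G g"
  shows "convol G (f + g) h = convol G f h + convol G g h"
  by (simp add: convol_def fun_eq_iff distrib_right infsum_add row_finite_summable assms)

lemma convol_add_right:
  assumes "row_finite G f"
  shows "convol G f (g + h) = convol G f g + convol G f h"
  by (simp add: convol_def fun_eq_iff distrib_left infsum_add row_finite_summable assms)

lemma convol_scale_left: "convol G (fun_scale a f) g = fun_scale a (convol G f g)"
  by (simp add: convol_def fun_scale_def fun_eq_iff mult.assoc infsum_cmult_right')

lemma convol_scale_right: "convol G f (fun_scale a g) = fun_scale a (convol G f g)"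
proof -
  have "f \<alpha> * (a * g \<beta>) = a * (f \<alpha> * g \<beta>)" for \<alpha> \<beta>
    by simp
  then show ?thesis
    by (simp only: convol_def fun_scale_def fun_eq_iff infsum_cmult_right') simp
qed

lemma convol_zero_left: "convol G 0 g = 0"
  by (simp add: convol_def fun_eq_iff)

lemma convol_zero_right: "convol G f 0 = 0"
  by (simp add: convol_def fun_eq_iff)

context groupoid
begin

lemma set_cmp_assoc:
  assumes "U \<subseteq> arrows G" "V \<subseteq> arrows G" "W \<subseteq> arrows G"
  shows "set_cmp G (set_cmp G U V) W = set_cmp G U (set_cmp G V W)"
proof (rule Set.set_eqI, rule iffI)
  fix x assume "x \<in> set_cmp G (set_cmp G U V) W"
  then obtain \<alpha> \<beta> \<gamma> where x: "x = cmp G (cmp G \<alpha> \<beta>) \<gamma>" "\<alpha> \<in> U" "\<beta> \<in> V" "\<gamma> \<in> W"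
      "src G \<alpha> = rng G \<beta>" "src G (cmp G \<alpha> \<beta>) = rng G \<gamma>"
    unfolding set_cmp_def by blast
  then have c: "(\<alpha>, \<beta>) \<in> composable G" using assms by (auto simp: composable_def)
  then have c': "(\<beta>, \<gamma>) \<in> composable G"
    using x assms by (auto simp: composable_def src_cmp)
  have "x = cmp G \<alpha> (cmp G \<beta> \<gamma>)" "src G \<alpha> = rng G (cmp G \<beta> \<gamma>)" "src G \<beta> = rng G \<gamma>"
    using x c c' by (simp_all add: cmp_assoc rng_cmp src_cmp)
  then show "x \<in> set_cmp G U (set_cmp G V W)"
    using x unfolding set_cmp_def by blast
next
  fix x assume "x \<in> set_cmp G U (set_cmp G V W)"
  then obtain \<alpha> \<beta> \<gamma> where x: "x = cmp G \<alpha> (cmp G \<beta> \<gamma>)" "\<alpha> \<in> U" "\<beta> \<in> V" "\<gamma> \<in> W"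
      "src G \<beta> = rng G \<gamma>" "src G \<alpha> = rng G (cmp G \<beta> \<gamma>)"
    unfolding set_cmp_def by blast
  then have c: "(\<beta>, \<gamma>) \<in> composable G" using assms by (auto simp: composable_def)
  then have c': "(\<alpha>, \<beta>) \<in> composable G"
    using x assms by (auto simp: composable_def rng_cmp)
  have "x = cmp G (cmp G \<alpha> \<beta>) \<gamma>" "src G (cmp G \<alpha> \<beta>) = rng G \<gamma>" "src G \<alpha> = rng G \<beta>"
    using x c c' by (simp_all add: cmp_assoc rng_cmp src_cmp)
  then show "x \<in> set_cmp G (set_cmp G U V) W"
    using x unfolding set_cmp_def by blast
qed

lemma convol_indicator:
  assumes U: "U \<subseteq> arrows G" "inj_on (rng G) U" and V: "V \<subseteq> arrows G"
  shows "convol G (indicator U) (indicator V) = indicator (set_cmp G U V)"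
proof
  fix \<gamma>
  let ?R = "{\<alpha> \<in> arrows G. rng G \<alpha> = rng G \<gamma>}"
  let ?h = "\<lambda>\<alpha>. indicator U \<alpha> * (indicator V (cmp G (ginv G \<alpha>) \<gamma>) :: complex)"
  show "convol G (indicator U) (indicator V) \<gamma> = (indicator (set_cmp G U V) \<gamma> :: complex)"
  proof (cases "\<gamma> \<in> set_cmp G U V")
    case True
    then obtain \<alpha> \<beta> where \<gamma>: "\<gamma> = cmp G \<alpha> \<beta>" "\<alpha> \<in> U" "\<beta> \<in> V" "src G \<alpha> = rng G \<beta>"
      unfolding set_cmp_def by blast
    then have c: "(\<alpha>, \<beta>) \<in> composable G" using U V by (auto simp: composable_def)
    then have arr: "\<alpha> \<in> arrows G" "\<beta> \<in> arrows G" "\<gamma> \<in> arrows G" "rng G \<alpha> = rng G \<gamma>"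
      using \<gamma> by (auto simp: composable_def cmp_closed rng_cmp)
    \<comment> \<open>By injectivity of the range map on \<open>U\<close>, \<alpha> is the only
      arrow of \<open>U\<close> with the range of \<gamma>, so the sum has a single term.\<close>
    have "infsum ?h ?R = infsum ?h {\<alpha>}"
    proof (rule infsum_cong_neutral)
      fix x assume x: "x \<in> ?R - {\<alpha>}"
      then have "x \<notin> U" using U(2) arr(4) \<gamma>(2) by (metis (mono_tags, lifting) DiffE inj_onD mem_Collect_eq singletonI)
      then show "?h x = 0" by simp
    qed (use arr in auto)
    also have "\<dots> = 1" using \<gamma> arr by (simp add: ginv_cmp_cancel)
    finally show ?thesis using True arr by (simp add: convol_def)
  next
    case False
    \<comment> \<open>A non-zero term would factor \<gamma> as a product of an arrow in
      \<open>U\<close> and an arrow in \<open>V\<close>.\<close>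
    have "?h \<alpha> = 0" if "\<alpha> \<in> ?R" "\<gamma> \<in> arrows G" for \<alpha>
    proof (rule ccontr)
      assume "?h \<alpha> \<noteq> 0"
      then have *: "\<alpha> \<in> U" "cmp G (ginv G \<alpha>) \<gamma> \<in> V"
        by (auto simp: indicator_def split: if_splits)
      have "\<gamma> = cmp G \<alpha> (cmp G (ginv G \<alpha>) \<gamma>)" "src G \<alpha> = rng G (cmp G (ginv G \<alpha>) \<gamma>)"
        using that by (simp_all add: cmp_ginv_cancel rng_cmp composableI ginv_closed src_ginv rng_ginv)
      then show False using False * unfolding set_cmp_def by blast
    qed
    then have "\<gamma> \<in> arrows G \<Longrightarrow> infsum ?h ?R = 0" by (intro infsum_0)
    then show ?thesis using False by (simp add: convol_def)
  qed
qed

end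

section \<open>Compact open bisections inside the fibres of the cocycle\<close>

locale graded_ample_groupoid = ample_groupoid G + grading: group \<Gamma>
  for G :: "('g, 'm) topgroupoid_scheme" and \<Gamma> :: "('h, 'k) monoid_scheme" +
  fixes c :: "'g \<Rightarrow> 'h"
  assumes cocycle: "continuous_cocycle G \<Gamma> c"
begin

lemma cocycle_closed: "\<alpha> \<in> arrows G \<Longrightarrow> c \<alpha> \<in> carrier \<Gamma>"
  using cocycle continuous_map_image_subset_topspace[of "gtop G" "discrete_topology (carrier \<Gamma>)" c]
  by (auto simp: continuous_cocycle_def topspace_gtop)

lemma openin_fibre: "openin (gtop G) (fibre G c n)"
proof (cases "n \<in> carrier \<Gamma>")
  case True
  then have "openin (gtop G) {x \<in> topspace (gtop G). c x \<in> {n}}"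
    using cocycle by (intro openin_continuous_map_preimage[of _ "discrete_topology (carrier \<Gamma>)"])
      (auto simp: continuous_cocycle_def)
  then show ?thesis by (simp add: fibre_def topspace_gtop)
next
  case False
  then have "fibre G c n = {}" using cocycle_closed by (auto simp: fibre_def)
  then show ?thesis by simp
qed

lemma Bco_iff:
  "U \<in> Bco G c n \<longleftrightarrow> compactin (gtop G) U \<and> openin (gtop G) U \<and>
    inj_on (rng G) U \<and> inj_on (src G) U \<and> U \<subseteq> fibre G c n"
  by (auto simp: Bco_def open_bisection_iff)

lemma Bco_clopen_subset:
  assumes "U \<in> Bco G c n" "V \<subseteq> U" "openin (gtop G) V" "closedin (gtop G) V"
  shows "V \<in> Bco G c n"
  using assms unfolding Bco_iff by (meson closed_compactin inj_on_subset subset_trans)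

lemma Bco_closedin: "U \<in> Bco G c n \<Longrightarrow> closedin (gtop G) U"
  using Hausdorff by (auto simp: Bco_iff intro: compactin_imp_closedin)

text \<open>\<open>W\<close> may have another degree; the result takes its degree from
  \<open>U\<close>. Compact sets in a Hausdorff space are closed, so \<open>W\<close> is clopen and
  cuts \<open>U\<close> into clopen pieces. The same applies to \<open>Bco_Diff\<close>.\<close>

lemma Bco_Int:
  assumes "U \<in> Bco G c n" "W \<in> Bco G c k"
  shows "U \<inter> W \<in> Bco G c n"
  using assms Bco_closedin[OF assms(1)] Bco_closedin[OF assms(2)]
  by (intro Bco_clopen_subset[OF assms(1)]) (auto simp: Bco_iff intro!: openin_Int closedin_Int)

lemma Bco_Diff:
  assumes "U \<in> Bco G c n" "W \<in> Bco G c k"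
  shows "U - W \<in> Bco G c n"
  using assms Bco_closedin[OF assms(1)] Bco_closedin[OF assms(2)]
  by (intro Bco_clopen_subset[OF assms(1)]) (auto simp: Bco_iff intro!: openin_diff closedin_diff)

lemma Bco_set_cmp:
  assumes U: "U \<in> Bco G c n" and V: "V \<in> Bco G c k"
  shows "set_cmp G U V \<in> Bco G c (n \<otimes>\<^bsub>\<Gamma>\<^esub> k)"
proof -
  have "set_cmp G U V \<subseteq> fibre G c (n \<otimes>\<^bsub>\<Gamma>\<^esub> k)"
  proof
    fix x assume "x \<in> set_cmp G U V"
    then obtain \<alpha> \<beta> where x: "x = cmp G \<alpha> \<beta>" "\<alpha> \<in> U" "\<beta> \<in> V" "src G \<alpha> = rng G \<beta>"
      unfolding set_cmp_def by blast
    then have \<alpha>\<beta>: "(\<alpha>, \<beta>) \<in> composable G" "c \<alpha> = n" "c \<beta> = k"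
      using U V by (auto simp: composable_def Bco_def fibre_def)
    then have "c x = n \<otimes>\<^bsub>\<Gamma>\<^esub> k"
      using cocycle x(1) by (auto simp: continuous_cocycle_def)
    then show "x \<in> fibre G c (n \<otimes>\<^bsub>\<Gamma>\<^esub> k)"
      using x(1) \<alpha>\<beta>(1) cmp_closed by (simp add: fibre_def)
  qed
  then show ?thesis
    using U V compactin_set_cmp open_bisection_set_cmp by (simp add: Bco_def)
qed

lemma Bco_all_Int: "U \<in> Bco_all G \<Gamma> c \<Longrightarrow> W \<in> Bco_all G \<Gamma> c \<Longrightarrow> U \<inter> W \<in> Bco_all G \<Gamma> c"
  using Bco_Int unfolding Bco_all_def by blast

lemma Bco_all_Diff: "U \<in> Bco_all G \<Gamma> c \<Longrightarrow> W \<in> Bco_all G \<Gamma> c \<Longrightarrow> U - W \<in> Bco_all G \<Gamma> c"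
  using Bco_Diff unfolding Bco_all_def by blast

lemma Bco_all_set_cmp:
  "U \<in> Bco_all G \<Gamma> c \<Longrightarrow> W \<in> Bco_all G \<Gamma> c \<Longrightarrow> set_cmp G U W \<in> Bco_all G \<Gamma> c"
  using Bco_set_cmp grading.m_closed unfolding Bco_all_def by blast

lemma Bco_allD:
  assumes "U \<in> Bco_all G \<Gamma> c"
  shows "U \<subseteq> arrows G" "inj_on (rng G) U"
  using assms by (auto simp: Bco_all_def Bco_iff fibre_def)

section \<open>Indicators of compact open bisections span A(G)\<close>

lemma indicator_in_A_deg:
  assumes U: "U \<in> Bco G c n"
  shows "indicator U \<in> A_deg G c n"
proof -
  have clopen: "openin (gtop G) U" "closedin (gtop G) U"
    using U Bco_closedin by (auto simp: Bco_iff)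
  have U_sub: "U \<subseteq> fibre G c n" "U \<subseteq> arrows G" "U \<subseteq> topspace (gtop G)"
    using U clopen(1) openin_subset topspace_gtop by (auto simp: Bco_iff)
  have supp: "supp (indicator U) = U" by (auto simp: supp_def indicator_def)
  have co: "openin (gtop G) (topspace (gtop G) - U)" using clopen(2) by blast
  have "openin (gtop G) {x \<in> topspace (gtop G). indicator U x \<in> S}" for S :: "complex set"
  proof -
    have "{x \<in> topspace (gtop G). indicator U x \<in> S} =
        (if 1 \<in> S then U else {}) \<union> (if 0 \<in> S then topspace (gtop G) - U else {})"
      using U_sub by (auto simp: indicator_def)
    then show ?thesis using clopen(1) co by (auto intro: openin_Un)
  qed
  then have "continuous_map (gtop G) euclidean (indicator U :: 'g \<Rightarrow> complex)"
    by (simp add: continuous_map)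
  moreover have "locally_constant (gtop G) (indicator U :: 'g \<Rightarrow> complex)"
    unfolding locally_constant_def
  proof
    fix x assume "x \<in> topspace (gtop G)"
    moreover have "(indicator U :: 'g \<Rightarrow> complex) constant_on U"
        "(indicator U :: 'g \<Rightarrow> complex) constant_on (topspace (gtop G) - U)"
      by (auto simp: constant_on_def indicator_def)
    ultimately show "\<exists>V. openin (gtop G) V \<and> x \<in> V \<and> (indicator U :: 'g \<Rightarrow> complex) constant_on V"
      using clopen(1) co by (metis DiffI)
  qed
  moreover have "gtop G closure_of U = U" using clopen(2) by (simp add: closure_of_closedin)
  ultimately show ?thesis
    using U U_sub by (simp add: A_deg_def Cc_def supp Bco_iff)
qed

text \<open>The members of \<open>\<F>\<close> may overlap, so each new \<open>W\<close> contributes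
  its constant times the indicator of the part not yet covered, which is again a compact open
  bisection.\<close>

lemma piecewise_constant_in_span:
  assumes "finite \<F>" "\<F> \<subseteq> Bco G c n" "n \<in> carrier \<Gamma>"
    and "\<And>U. U \<in> \<F> \<Longrightarrow> f constant_on U"
  shows "(\<lambda>x. f x * indicator (\<Union>\<F>) x) \<in> cfun.span (indicator ` Bco_all G \<Gamma> c)"
  using assms
proof (induction \<F>)
  case empty
  then show ?case using cfun.span_zero by (simp add: zero_fun_def)
next
  case (insert W \<F>)
  obtain k where k: "\<And>x. x \<in> W \<Longrightarrow> f x = k"
    using insert.prems(3)[of W] by (auto simp: constant_on_def)
  have "W - \<Union>\<D> \<in> Bco G c n" if "finite \<D>" "\<D> \<subseteq> Bco G c n" for \<D>
    using that
  proof (induction \<D>)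
    case empty
    then show ?case using insert.prems by simp
  next
    case (insert V \<D>)
    then have "(W - \<Union>\<D>) - V \<in> Bco G c n" by (simp add: Bco_Diff[where k = n])
    moreover have "(W - \<Union>\<D>) - V = W - \<Union>(insert V \<D>)" by blast
    ultimately show ?case by metis
  qed
  then have "W - \<Union>\<F> \<in> Bco_all G \<Gamma> c"
    using insert unfolding Bco_all_def by blast
  then have "fun_scale k (indicator (W - \<Union>\<F>)) \<in> cfun.span (indicator ` Bco_all G \<Gamma> c)"
    by (intro cfun.span_scale cfun.span_base) simp
  then have "(\<lambda>x. f x * indicator (\<Union>\<F>) x) + fun_scale k (indicator (W - \<Union>\<F>))
      \<in> cfun.span (indicator ` Bco_all G \<Gamma> c)"
    using insert by (intro cfun.span_add) auto
  moreover have "(\<lambda>x. f x * indicator (\<Union>\<F>) x) + fun_scale k (indicator (W - \<Union>\<F>))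
      = (\<lambda>x. f x * indicator (\<Union>(insert W \<F>)) x)"
    using k by (auto simp: fun_eq_iff fun_scale_def indicator_def)
  ultimately show ?case by metis
qed

text \<open>Compactness of the support yields a finite cover by compact open bisections on each of
  which \<open>f\<close> is constant.\<close>

lemma A_deg_subset_span:
  assumes n: "n \<in> carrier \<Gamma>"
  shows "A_deg G c n \<subseteq> cfun.span (indicator ` Bco_all G \<Gamma> c)"
proof
  fix f assume f: "f \<in> A_deg G c n"
  then have loc: "locally_constant (gtop G) f" and supp: "supp f \<subseteq> fibre G c n" "supp f \<subseteq> arrows G"
    by (auto simp: A_deg_def Cc_def)
  \<comment> \<open>Here \<open>supp\<close> is the set where \<open>f\<close> is non-zero, without
    closure. Local constancy makes it closed, so the compactness in \<open>Cc\<close> holds for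
    \<open>supp f\<close> itself.\<close>
  have "closedin (gtop G) (supp f)"
  proof -
    have "openin (gtop G) (topspace (gtop G) - supp f)"
    proof (subst openin_subopen, intro ballI)
      fix x assume x: "x \<in> topspace (gtop G) - supp f"
      then obtain U where U: "openin (gtop G) U" "x \<in> U" "f constant_on U"
        using loc by (auto simp: locally_constant_def)
      then have "U \<subseteq> topspace (gtop G) - supp f"
        using x openin_subset[OF U(1)] by (auto simp: constant_on_def supp_def)
      then show "\<exists>T. openin (gtop G) T \<and> x \<in> T \<and> T \<subseteq> topspace (gtop G) - supp f"
        using U by blast
    qed
    then show ?thesis using supp(2) by (simp add: closedin_def topspace_gtop)
  qed
  then have supp_compact: "compactin (gtop G) (supp f)"
    using f by (simp add: A_deg_def Cc_def closure_of_closedin)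
  let ?\<U> = "{U \<in> Bco G c n. f constant_on U}"
  have "supp f \<subseteq> \<Union>?\<U>"
  proof
    fix x assume x: "x \<in> supp f"
    then obtain W where W: "openin (gtop G) W" "x \<in> W" "f constant_on W"
      using loc supp(2) topspace_gtop unfolding locally_constant_def by blast
    then have "openin (gtop G) (W \<inter> fibre G c n)" "x \<in> W \<inter> fibre G c n"
      using x supp(1) openin_fibre by auto
    then obtain U where "compactin (gtop G) U" "open_bisection G U" "x \<in> U" "U \<subseteq> W \<inter> fibre G c n"
      by (rule exists_compact_open_bisection)
    then show "x \<in> \<Union>?\<U>"
      using W(3) unfolding Bco_def by (blast intro: constant_on_subset)
  qed
  moreover have "openin (gtop G) U" if "U \<in> ?\<U>" for U
    using that by (simp add: Bco_iff)
  ultimately obtain \<F> where \<F>: "finite \<F>" "\<F> \<subseteq> ?\<U>" "supp f \<subseteq> \<Union>\<F>"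
    using compactinD[OF supp_compact, of ?\<U>] by blast
  have "(\<lambda>x. f x * indicator (\<Union>\<F>) x) \<in> cfun.span (indicator ` Bco_all G \<Gamma> c)"
    using \<F> n by (intro piecewise_constant_in_span) auto
  moreover have "f x * indicator (\<Union>\<F>) x = f x" for x
    using \<F>(3) by (auto simp: supp_def indicator_def)
  ultimately show "f \<in> cfun.span (indicator ` Bco_all G \<Gamma> c)"
    by simp
qed

lemma A_set_eq_span: "A_set G \<Gamma> c = cfun.span (indicator ` Bco_all G \<Gamma> c)"
proof
  show "A_set G \<Gamma> c \<subseteq> cfun.span (indicator ` Bco_all G \<Gamma> c)"
    unfolding A_set_def using A_deg_subset_span
    by (intro cfun.span_minimal cfun.subspace_span) blast
  show "cfun.span (indicator ` Bco_all G \<Gamma> c) \<subseteq> A_set G \<Gamma> c"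
    unfolding A_set_def using indicator_in_A_deg
    by (intro cfun.span_mono) (force simp: Bco_all_def)
qed

text \<open>Span induction over the indicators, with membership of the remainder \<open>g\<close>
  carried along: the additivity of convolution needs \<open>g\<close> to be row finite.\<close>

lemma A_set_induct [consumes 1, case_names zero add]:
  assumes f: "f \<in> A_set G \<Gamma> c" and zero: "P 0"
    and add: "\<And>a U g. U \<in> Bco_all G \<Gamma> c \<Longrightarrow> g \<in> A_set G \<Gamma> c \<Longrightarrow> P g \<Longrightarrow>
      P (fun_scale a (indicator U) + g)"
  shows "P f"
proof -
  have "f \<in> A_set G \<Gamma> c \<and> P f"
    using f[unfolded A_set_eq_span]
  proof (induction f rule: cfun.span_induct_alt[where h = "\<lambda>f. f \<in> A_set G \<Gamma> c \<and> P f"])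
    case base
    show ?case using zero cfun.span_zero by (simp add: A_set_eq_span)
  next
    case (step a x y)
    then obtain U where U: "U \<in> Bco_all G \<Gamma> c" "x = indicator U" by blast
    have "fun_scale a x + y \<in> A_set G \<Gamma> c"
      using step unfolding A_set_eq_span
      by (intro cfun.span_add cfun.span_scale) (auto intro: cfun.span_base)
    with add[OF U(1), of y a] step U(2) show ?case by simp
  qed
  then show ?thesis ..
qed

section \<open>A(G) as a complex algebra under convolution\<close>

lemma A_set_row_finite:
  assumes "f \<in> A_set G \<Gamma> c"
  shows "row_finite G f"
  using assms
  by (induction f rule: A_set_induct[where P = "row_finite G"])
    (auto intro!: row_finite_zero row_finite_add row_finite_scale row_finite_indicator dest: Bco_allD)

lemma A_set_zero: "0 \<in> A_set G \<Gamma> c"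
  by (simp add: A_set_def cfun.span_zero)

lemma A_set_add: "f \<in> A_set G \<Gamma> c \<Longrightarrow> g \<in> A_set G \<Gamma> c \<Longrightarrow> f + g \<in> A_set G \<Gamma> c"
  unfolding A_set_def by (rule cfun.span_add)

lemma A_set_scale: "f \<in> A_set G \<Gamma> c \<Longrightarrow> fun_scale a f \<in> A_set G \<Gamma> c"
  unfolding A_set_def by (rule cfun.span_scale)

lemma A_set_indicator: "U \<in> Bco_all G \<Gamma> c \<Longrightarrow> indicator U \<in> A_set G \<Gamma> c"
  unfolding A_set_eq_span by (intro cfun.span_base) blast

lemma convol_indicator_Bco:
  "U \<in> Bco_all G \<Gamma> c \<Longrightarrow> V \<in> Bco_all G \<Gamma> c \<Longrightarrow>
    convol G (indicator U) (indicator V) = indicator (set_cmp G U V)"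
  by (simp add: convol_indicator Bco_allD)

text \<open>Bilinearity reduces the claim to two indicators, whose convolution is the indicator of
  the product bisection.\<close>

lemma A_set_convol:
  assumes f: "f \<in> A_set G \<Gamma> c" and g: "g \<in> A_set G \<Gamma> c"
  shows "convol G f g \<in> A_set G \<Gamma> c"
  using f
proof (induction f rule: A_set_induct[where P = "\<lambda>f. convol G f g \<in> A_set G \<Gamma> c"])
  case (add a U f)
  have "convol G (indicator U) g \<in> A_set G \<Gamma> c"
    using g
  proof (induction g rule: A_set_induct[where P = "\<lambda>g. convol G (indicator U) g \<in> A_set G \<Gamma> c"])
    case (add b V g)
    have "convol G (indicator U) (fun_scale b (indicator V) + g)
        = fun_scale b (indicator (set_cmp G U V)) + convol G (indicator U) g"
      using add \<open>U \<in> Bco_all G \<Gamma> c\<close>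
      by (simp add: convol_add_right A_set_row_finite A_set_indicator convol_scale_right
          convol_indicator_Bco)
    then show ?case
      using add \<open>U \<in> Bco_all G \<Gamma> c\<close>
      by (simp add: A_set_add A_set_scale A_set_indicator Bco_all_set_cmp)
  qed (simp add: convol_zero_right A_set_zero)
  then show ?case
    using add by (simp add: convol_add_left convol_scale_left A_set_row_finite A_set_scale
        A_set_indicator A_set_add)
qed (simp add: convol_zero_left A_set_zero)

text \<open>By trilinearity it is enough to treat three indicators, where the claim is associativity
  of the product of sets. The arguments are released one at a time, beginning with
  \<open>h\<close>.\<close>

lemma convol_assoc:
  assumes f: "f \<in> A_set G \<Gamma> c" and g: "g \<in> A_set G \<Gamma> c" and h: "h \<in> A_set G \<Gamma> c"
  shows "convol G (convol G f g) h = convol G f (convol G g h)"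
proof -
  note linear = convol_add_left convol_add_right convol_scale_left convol_scale_right
    A_set_row_finite A_set_scale A_set_indicator A_set_convol
  have 1: "convol G (convol G (indicator U) (indicator V)) h
      = convol G (indicator U) (convol G (indicator V) h)"
    if UV: "U \<in> Bco_all G \<Gamma> c" "V \<in> Bco_all G \<Gamma> c" for U V
    using h
  proof (induction h rule: A_set_induct[where P = "\<lambda>h. convol G (convol G (indicator U) (indicator V)) h
      = convol G (indicator U) (convol G (indicator V) h)"])
    case (add b W h)
    have "convol G (convol G (indicator U) (indicator V)) (indicator W)
        = convol G (indicator U) (convol G (indicator V) (indicator W))"
      using UV add(1)
      by (simp add: convol_indicator_Bco Bco_all_set_cmp set_cmp_assoc Bco_allD)
    then show ?case using UV add by (simp add: linear)
  qed (simp add: convol_zero_right)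
  have 2: "convol G (convol G (indicator U) g) h = convol G (indicator U) (convol G g h)"
    if U: "U \<in> Bco_all G \<Gamma> c" for U
    using g
  proof (induction g rule: A_set_induct[where P = "\<lambda>g. convol G (convol G (indicator U) g) h
      = convol G (indicator U) (convol G g h)"])
    case (add b V g)
    then show ?case using U h 1 by (simp add: linear)
  qed (simp add: convol_zero_right convol_zero_left)
  show ?thesis
    using f
  proof (induction f rule: A_set_induct[where P = "\<lambda>f. convol G (convol G f g) h = convol G f (convol G g h)"])
    case (add b U f)
    then show ?case using g h 2 by (simp add: linear)
  qed (simp add: convol_zero_left)
qed

lemma A_alg_simps [simp]:
  "carrier (A_alg G \<Gamma> c) = A_set G \<Gamma> c" "monoid.mult (A_alg G \<Gamma> c) = convol G"
  "ring.zero (A_alg G \<Gamma> c) = 0" "add (A_alg G \<Gamma> c) = (+)" "smult (A_alg G \<Gamma> c) = fun_scale"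
  by (simp_all add: A_alg_def)

lemma complex_algebra_A_alg: "complex_algebra (A_alg G \<Gamma> c)"
proof (intro complex_algebra.intro complex_algebra_axioms.intro)
  show "Module.module complex_field (A_alg G \<Gamma> c)"
  proof (rule moduleI)
    show "abelian_group (A_alg G \<Gamma> c)"
    proof (rule abelian_groupI)
      fix f assume f: "f \<in> carrier (A_alg G \<Gamma> c)"
      then have "- f \<in> A_set G \<Gamma> c" using A_set_scale[of f "-1"] by simp
      then show "\<exists>g\<in>carrier (A_alg G \<Gamma> c). g \<oplus>\<^bsub>A_alg G \<Gamma> c\<^esub> f = \<zero>\<^bsub>A_alg G \<Gamma> c\<^esub>"
        by (intro bexI[of _ "- f"]) simp_all
    qed (simp_all add: A_set_add A_set_zero add.assoc add.commute)
  qed (simp_all add: cring_complex_field A_set_scale cfun.scale_left_distrib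
      cfun.scale_right_distrib)
qed (simp_all add: A_set_convol convol_assoc convol_add_left convol_add_right A_set_row_finite
    convol_scale_left convol_scale_right)

section \<open>The universal property of the indicators\<close>

lemma Bco_representation_indicator: "Bco_representation G \<Gamma> c (A_alg G \<Gamma> c) indicator"
  unfolding Bco_representation_def
proof (intro conjI ballI impI)
  fix n and U V :: "'g set" assume "U \<inter> V = {}"
  then show "indicator U \<oplus>\<^bsub>A_alg G \<Gamma> c\<^esub> indicator V = indicator (U \<union> V)"
    by (auto simp: fun_eq_iff indicator_def)
qed (auto simp: complex_algebra_A_alg A_set_indicator convol_indicator_Bco fun_eq_iff)

text \<open>\<open>U \<inter> W\<close> and \<open>U - W\<close> are disjoint and both have the
  degree of \<open>U\<close>, so (R3) applies to them whatever the degree of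
  \<open>W\<close>.\<close>

lemma Bco_representation_additive:
  assumes t: "Bco_representation G \<Gamma> c B t"
  shows "additive_set_function B (Bco_all G \<Gamma> c) t"
proof (intro additive_set_function.intro additive_set_function_axioms.intro)
  fix U W assume U: "U \<in> Bco_all G \<Gamma> c" and W: "W \<in> Bco_all G \<Gamma> c"
  then obtain n k where n: "n \<in> carrier \<Gamma>" "U \<in> Bco G c n" and k: "W \<in> Bco G c k"
    unfolding Bco_all_def by blast
  have "U \<inter> W \<inter> (U - W) = {}" "U \<inter> W \<union> (U - W) = U" by blast+
  with n Bco_Int[OF n(2) k] Bco_Diff[OF n(2) k] t
  show "t U = t (U \<inter> W) \<oplus>\<^bsub>B\<^esub> t (U - W)"
    unfolding Bco_representation_def by metis
qed (use t Bco_all_Int Bco_all_Diff in \<open>auto simp: Bco_representation_def\<close>)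

lemma lin_comb_indicator_apply:
  "lin_comb (A_alg G \<Gamma> c) indicator ps x = (\<Sum>(a, U)\<leftarrow>ps. a * indicator U x)"
  by (induction ps) (auto simp: fun_scale_def)

lemma A_set_lin_comb:
  assumes "f \<in> A_set G \<Gamma> c"
  obtains ps where "snd ` set ps \<subseteq> Bco_all G \<Gamma> c" "f = lin_comb (A_alg G \<Gamma> c) indicator ps"
proof -
  have "\<exists>ps. snd ` set ps \<subseteq> Bco_all G \<Gamma> c \<and> f = lin_comb (A_alg G \<Gamma> c) indicator ps"
    using assms
  proof (induction f rule: A_set_induct[where P = "\<lambda>f. \<exists>ps. snd ` set ps \<subseteq> Bco_all G \<Gamma> c \<and>
        f = lin_comb (A_alg G \<Gamma> c) indicator ps"])
    case zero
    show ?case by (rule exI[of _ "[]"]) simp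
  next
    case (add a U g)
    then obtain ps where "snd ` set ps \<subseteq> Bco_all G \<Gamma> c" "g = lin_comb (A_alg G \<Gamma> c) indicator ps"
      by blast
    with add show ?case by (intro exI[of _ "(a, U) # ps"]) simp
  qed
  with that show thesis by blast
qed

lemma algebra_hom_lin_comb:
  assumes \<pi>: "\<pi> \<in> algebra_hom (A_alg G \<Gamma> c) B" and B: "complex_algebra B"
    and t: "\<And>U. U \<in> Bco_all G \<Gamma> c \<Longrightarrow> \<pi> (indicator U) = t U"
    and ps: "snd ` set ps \<subseteq> Bco_all G \<Gamma> c"
  shows "\<pi> (lin_comb (A_alg G \<Gamma> c) indicator ps) = lin_comb B t ps"
  using ps
proof (induction ps)
  case Nil
  interpret B: complex_algebra B by (rule B)
  \<comment> \<open>Preservation of zero is not part of \<open>algebra_hom\<close>; it follows from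
    compatibility with the scalar 0.\<close>
  have "\<pi> (a \<odot>\<^bsub>A_alg G \<Gamma> c\<^esub> 0) = a \<odot>\<^bsub>B\<^esub> \<pi> 0" "\<pi> 0 \<in> carrier B" for a
    using \<pi> A_set_zero unfolding algebra_hom_def A_alg_simps by blast+
  from this(1)[of 0] this(2) have "\<pi> 0 = 0 \<odot>\<^bsub>B\<^esub> \<pi> 0" "\<pi> 0 \<in> carrier B" by simp_all
  then show ?case using B.smult_l_null[of "\<pi> 0"] by (simp add: zero_fun_def)
next
  case (Cons p ps)
  interpret A: complex_algebra "A_alg G \<Gamma> c" by (rule complex_algebra_A_alg)
  have "indicator (snd p) \<in> A_set G \<Gamma> c" "lin_comb (A_alg G \<Gamma> c) indicator ps \<in> A_set G \<Gamma> c"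
    using Cons.prems A.lin_comb_closed[of ps "Bco_all G \<Gamma> c" indicator] A_set_indicator by auto
  with Cons \<pi> t A_set_scale
  have "\<pi> (fun_scale (fst p) (indicator (snd p)) + lin_comb (A_alg G \<Gamma> c) indicator ps)
      = fst p \<odot>\<^bsub>B\<^esub> t (snd p) \<oplus>\<^bsub>B\<^esub> lin_comb B t ps"
    by (auto simp: algebra_hom_def)
  then show ?case by (simp add: plus_fun_def)
qed

lemma universal_representation:
  assumes t: "Bco_representation G \<Gamma> c B t"
  shows "\<exists>!\<pi>. \<pi> \<in> algebra_hom (A_alg G \<Gamma> c) B \<and> (\<forall>U\<in>Bco_all G \<Gamma> c. \<pi> (indicator U) = t U)"
proof -
  let ?A = "A_alg G \<Gamma> c" and ?S = "Bco_all G \<Gamma> c"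
  interpret A: complex_algebra ?A by (rule complex_algebra_A_alg)
  interpret t: additive_set_function B ?S t by (rule Bco_representation_additive[OF t])
  have ind: "indicator ` ?S \<subseteq> carrier ?A" using A_set_indicator by auto
  have tS: "t ` ?S \<subseteq> carrier B" by (rule t.values_closed)
  have t_mult: "t U \<otimes>\<^bsub>B\<^esub> t V = t (set_cmp G U V)" if "U \<in> ?S" "V \<in> ?S" for U V
    using t that by (simp add: Bco_representation_def)
  \<comment> \<open>The value at \<open>f\<close> is read off from any formal combination
    representing \<open>f\<close>. The restriction to \<open>A_set G \<Gamma> c\<close> makes the
    map extensional, as \<open>algebra_hom\<close> requires.\<close>
  define \<pi> where "\<pi> = (\<lambda>f\<in>A_set G \<Gamma> c.
    lin_comb B t (SOME ps. snd ` set ps \<subseteq> ?S \<and> f = lin_comb ?A indicator ps))"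
  have closed: "lin_comb ?A indicator ps \<in> A_set G \<Gamma> c" if "snd ` set ps \<subseteq> ?S" for ps
    using A.lin_comb_closed[OF that ind] by simp
  \<comment> \<open>The chosen combination may differ from \<open>ps\<close>, but both represent the
    same function, so \<open>lin_comb_eqI\<close> gives equal values under \<open>t\<close>.\<close>
  have \<pi>: "\<pi> (lin_comb ?A indicator ps) = lin_comb B t ps" if ps: "snd ` set ps \<subseteq> ?S" for ps
  proof -
    define qs where
      "qs = (SOME qs. snd ` set qs \<subseteq> ?S \<and> lin_comb ?A indicator ps = lin_comb ?A indicator qs)"
    have "snd ` set qs \<subseteq> ?S \<and> lin_comb ?A indicator ps = lin_comb ?A indicator qs"
      unfolding qs_def by (rule someI[of _ ps]) (simp add: ps)
    then have "lin_comb B t qs = lin_comb B t ps"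
      using ps by (intro t.lin_comb_eqI) (auto simp flip: lin_comb_indicator_apply)
    then show ?thesis using closed[OF ps] by (simp add: \<pi>_def qs_def)
  qed
  have "\<pi> \<in> algebra_hom ?A B"
    unfolding algebra_hom_def
  proof (intro CollectI conjI ballI allI)
    show "\<pi> \<in> carrier ?A \<rightarrow>\<^sub>E carrier B"
    proof (intro PiE_I)
      fix f assume "f \<in> carrier ?A"
      then obtain ps where "snd ` set ps \<subseteq> ?S" "f = lin_comb ?A indicator ps"
        using A_set_lin_comb by auto
      then show "\<pi> f \<in> carrier B" using \<pi> t.lin_comb_closed[OF _ tS] by simp
    qed (simp add: \<pi>_def)
  next
    fix f g assume "f \<in> carrier ?A" "g \<in> carrier ?A"
    then obtain ps qs where ps: "snd ` set ps \<subseteq> ?S" "f = lin_comb ?A indicator ps"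
      and qs: "snd ` set qs \<subseteq> ?S" "g = lin_comb ?A indicator qs"
      using A_set_lin_comb by (metis A_alg_simps(1))
    have "f \<oplus>\<^bsub>?A\<^esub> g = lin_comb ?A indicator (ps @ qs)"
      using A.lin_comb_append[OF ps(1) qs(1) ind] ps(2) qs(2) by simp
    then show "\<pi> (f \<oplus>\<^bsub>?A\<^esub> g) = \<pi> f \<oplus>\<^bsub>B\<^esub> \<pi> g"
      using ps qs t.lin_comb_append[OF ps(1) qs(1) tS] by (simp add: \<pi> image_Un)
    \<comment> \<open>One formal product serves both sides: it evaluates to the convolution by
      \<open>convol_indicator_Bco\<close> and to the product in \<open>B\<close> by (R2).\<close>
    let ?m = "lin_comb_mult (set_cmp G) ps qs"
    have "f \<otimes>\<^bsub>?A\<^esub> g = lin_comb ?A indicator ?m"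
      using A.lin_comb_mult[OF ps(1) qs(1) ind, of "set_cmp G"] ps(2) qs(2)
      by (simp add: Bco_all_set_cmp convol_indicator_Bco)
    moreover have "snd ` set ?m \<subseteq> ?S"
      using ps qs Bco_all_set_cmp by (intro snd_lin_comb_mult)
    ultimately show "\<pi> (f \<otimes>\<^bsub>?A\<^esub> g) = \<pi> f \<otimes>\<^bsub>B\<^esub> \<pi> g"
      using ps qs t.lin_comb_mult[OF ps(1) qs(1) tS, of "set_cmp G"]
      by (simp add: \<pi> Bco_all_set_cmp t_mult)
  next
    fix a f assume "f \<in> carrier ?A"
    then obtain ps where ps: "snd ` set ps \<subseteq> ?S" "f = lin_comb ?A indicator ps"
      using A_set_lin_comb by auto
    have "a \<odot>\<^bsub>?A\<^esub> f = lin_comb ?A indicator (lin_comb_scale a ps)"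
      using A.lin_comb_scale[OF ps(1) ind] ps(2) by simp
    then show "\<pi> (a \<odot>\<^bsub>?A\<^esub> f) = a \<odot>\<^bsub>B\<^esub> \<pi> f"
      using ps t.lin_comb_scale[OF ps(1) tS] by (simp add: \<pi>)
  qed
  moreover have "\<pi> (indicator U) = t U" if "U \<in> ?S" for U
  proof -
    have "lin_comb ?A indicator [(1, U)] = indicator U" by simp
    moreover have "lin_comb B t [(1, U)] = t U"
      using that tS t.smult_one[of "t U"] by auto
    ultimately show ?thesis using \<pi>[of "[(1, U)]"] that by auto
  qed
  \<comment> \<open>Both maps are determined on formal combinations of indicators, which exhaust
    A(G), and both are \<open>undefined\<close> elsewhere.\<close>
  moreover have "\<rho> = \<sigma>"
    if \<rho>: "\<rho> \<in> algebra_hom ?A B" "\<And>U. U \<in> ?S \<Longrightarrow> \<rho> (indicator U) = t U"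
      and \<sigma>: "\<sigma> \<in> algebra_hom ?A B" "\<And>U. U \<in> ?S \<Longrightarrow> \<sigma> (indicator U) = t U" for \<rho> \<sigma>
  proof (rule PiE_ext)
    show "\<rho> \<in> carrier ?A \<rightarrow>\<^sub>E carrier B" "\<sigma> \<in> carrier ?A \<rightarrow>\<^sub>E carrier B"
      using \<rho>(1) \<sigma>(1) by (simp_all add: algebra_hom_def)
    fix f assume "f \<in> carrier ?A"
    then obtain ps where ps: "snd ` set ps \<subseteq> ?S" "f = lin_comb ?A indicator ps"
      using A_set_lin_comb by auto
    then show "\<rho> f = \<sigma> f"
      using algebra_hom_lin_comb[OF \<rho>(1) t.complex_algebra_axioms \<rho>(2) ps(1)]
        algebra_hom_lin_comb[OF \<sigma>(1) t.complex_algebra_axioms \<sigma>(2) ps(1)] by simp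
  qed
  ultimately show ?thesis by blast
qed

end

theorem theorem3p11:
  fixes G :: "'g topgroupoid" and \<Gamma> :: "'h monoid" and c :: "'g \<Rightarrow> 'h"
  assumes "group \<Gamma>"
    and "topological_groupoid G"
    and "locally_compact_space (gtop G)"
    and "Hausdorff_space (gtop G)"
    and "has_clopen_basis (unit_top G)"
    and "local_homeomorphism (gtop G) (unit_top G) (src G)"
    and "continuous_cocycle G \<Gamma> c"
  shows "Bco_representation G \<Gamma> c (A_alg G \<Gamma> c) indicator \<and>
    cfun.span (indicator ` Bco_all G \<Gamma> c) = A_set G \<Gamma> c \<and>
    (\<forall>(B :: (complex, 'b) module) t. Bco_representation G \<Gamma> c B t \<longrightarrow>
      (\<exists>!\<pi>. \<pi> \<in> algebra_hom (A_alg G \<Gamma> c) B \<and> (\<forall>U\<in>Bco_all G \<Gamma> c. \<pi> (indicator U) = t U)))"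
proof -
  interpret graded_ample_groupoid G \<Gamma> c
    using assms by (intro graded_ample_groupoid.intro ample_groupoid.intro
        ample_groupoid_axioms.intro graded_ample_groupoid_axioms.intro)
  show ?thesis
    using Bco_representation_indicator A_set_eq_span universal_representation by blast
qed

end
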